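(* If $A$ is a connected non-degenerate allowable graph in $G_X$, then the characteristic polynomial $\chi_A(t)$ is irreducible as a polynomial in $\mathbb Z[t,\xi_1,\dots,\xi_m]$.
   Context: $e_1,\dots,e_m$ is the standard basis of $\mathbb Z^m$. $G=\mathbb Z^m\rtimes\mathbb Z/(2)$ consists of elements $a=(a,+)$ (black) and $a\tau=(a,-)$ (red), $a\in\mathbb Z^m$, with $\tau^2=1$, $\tau a=(-a)\tau$. Let $X=\{e_i-e_j: i\ne j\}\cup\{(-e_i-e_j)\tau: i\neq j\}$. In the Cayley graph $G_X$, $u,v\in G$ are joined by an edge marked $x\in X$ when $v=xu$. A graph in $G_X$ means a finite non-empty complete (i.e. induced) subgraph, identified with its vertex set $A\subset G$. Non-degenerate: for one (equivalently any) $g\in A$, the $\mathbb Z^m$-components of the elements of $Ag^{-1}$ different from the identity are $|A|-1$ linearly independent vectors. Allowable: $A$ does not contain a pair of vertices $a$ (black) and $b\tau$ (red), $a,b\in\mathbb Z^m$, with $a+b=-2e_i$ or $a+b=-3e_i+e_j$ for some indices $i\ne j$. $C_A=(c_{u,v})_{u,v\in A}$ is defined, writing $a(\xi)=\sum_i a_i\xi_i$, by $c_{a,a}=-a(\xi)$; $c_{a\tau,a\tau}=a(\xi)$; $c_{a,b}=2\sqrt{\xi_i\xi_j}$ and $c_{a\tau,b\tau}=-2\sqrt{\xi_i\xi_j}$ if the two elements are joined by an edge marked $e_i-e_j$; $c_{a,b\tau}=-2\sqrt{\xi_i\xi_j}$ and $c_{b\tau,a}=2\sqrt{\xi_i\xi_j}$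 if $a,b\tau$ are joined by an edge marked $(-e_i-e_j)\tau$; all other entries are $0$. $\chi_A(t)=\det(tI-C_A)$, which lies in $\mathbb Z[t,\xi_1,\dots,\xi_m]$. *)

theory Defs
  imports
    "HOL-Analysis.Cartesian_Euclidean_Space"
    "HOL-Library.Poly_Mapping"
    "Jordan_Normal_Form.Char_Poly"
begin

no_notation Matrix.vec_index (infixl \<open>$\<close> 100)

section \<open>The group \<open>\<int>\<^sup>m \<rtimes> \<int>/(2)\<close>\<close>

text \<open>\<open>Black a\<close> is \<open>(a,+)\<close>, and \<open>Red a\<close> is \<open>a\<tau> = (a,-)\<close>.
  The number \<open>m\<close> is \<open>CARD('m)\<close>.\<close>

datatype ('m :: finite) elt = Black "int ^ 'm" | Red "int ^ 'm"

fun lattice_part :: "'m :: finite elt \<Rightarrow> int ^ 'm" where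
  "lattice_part (Black a) = a"
| "lattice_part (Red a) = a"

text \<open>Since \<open>\<tau>b = (-b)\<tau>\<close>, moving \<open>\<tau>\<close> past a lattice vector changes its sign.\<close>

fun gmult :: "'m :: finite elt \<Rightarrow> 'm elt \<Rightarrow> 'm elt" (infixl \<open>\<otimes>\<^sub>G\<close> 70) where
  "Black a \<otimes>\<^sub>G Black b = Black (a + b)"
| "Black a \<otimes>\<^sub>G Red b = Red (a + b)"
| "Red a \<otimes>\<^sub>G Black b = Red (a - b)"
| "Red a \<otimes>\<^sub>G Red b = Black (a - b)"

abbreviation gone :: "'m :: finite elt" where
  "gone \<equiv> Black 0"

fun ginv :: "'m :: finite elt \<Rightarrow> 'm elt" where
  "ginv (Black a) = Black (- a)"
| "ginv (Red a) = Red a"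

lemma group_elt: "Groups.group gmult gone ginv"
proof
  fix u v w :: "'m :: finite elt"
  show "u \<otimes>\<^sub>G v \<otimes>\<^sub>G w = u \<otimes>\<^sub>G (v \<otimes>\<^sub>G w)"
    by (cases u; cases v; cases w) (simp_all add: algebra_simps)
  show "gone \<otimes>\<^sub>G u = u" "ginv u \<otimes>\<^sub>G u = gone"
    by (cases u; simp)+
qed

section \<open>The Cayley graph and its finite complete subgraphs\<close>

abbreviation e :: "'m :: finite \<Rightarrow> int ^ 'm" where
  "e i \<equiv> axis i 1"

definition gens :: "'m :: finite elt set" where
  "gens = {Black (e i - e j) | i j. i \<noteq> j} \<union> {Red (- e i - e j) | i j. i \<noteq> j}"

definition marked_edge :: "'m :: finite elt \<Rightarrow> 'm elt \<Rightarrow> 'm elt \<Rightarrow> bool" where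
  "marked_edge x u v \<longleftrightarrow> x \<in> gens \<and> v = x \<otimes>\<^sub>G u"

text \<open>A complete subgraph is given by its set of vertices.\<close>

definition is_graph :: "'m :: finite elt set \<Rightarrow> bool" where
  "is_graph A \<longleftrightarrow> finite A \<and> A \<noteq> {}"

definition connected_graph :: "'m :: finite elt set \<Rightarrow> bool" where
  "connected_graph A \<longleftrightarrow>
     (\<forall>u\<in>A. \<forall>v\<in>A. (u, v) \<in> {(p, q). p \<in> A \<and> q \<in> A \<and> (\<exists>x. marked_edge x p q)}\<^sup>*)"

text \<open>Linear independence is that of the family indexed by the non-identity elements of
  \<open>Ag\<^sup>-\<^sup>1\<close>, whence the injectivity; for integer vectors, independence over \<open>\<int>\<close>, \<open>\<rat>\<close> and \<open>\<real>\<close>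
  is the same.\<close>

definition nondegenerate :: "'m :: finite elt set \<Rightarrow> bool" where
  "nondegenerate A \<longleftrightarrow>
     (\<exists>g\<in>A. let D = (\<lambda>h. h \<otimes>\<^sub>G ginv g) ` A - {gone} in
        inj_on lattice_part D \<and>
        independent ((\<lambda>h. (\<chi> i. real_of_int (lattice_part h $ i)) :: real ^ 'm) ` D))"

definition allowable :: "'m :: finite elt set \<Rightarrow> bool" where
  "allowable A \<longleftrightarrow>
     \<not> (\<exists>a b. Black a \<in> A \<and> Red b \<in> A \<and>
          ((\<exists>i. a + b = - 2 *s e i) \<or> (\<exists>i j. i \<noteq> j \<and> a + b = - 3 *s e i + e j)))"

section \<open>The matrix and its characteristic polynomial\<close>

text \<open>Polynomials over \<open>\<int>\<close> in variables indexed by \<open>'m\<close>. The matrix has its entries in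
  \<open>\<int>[\<surd>\<xi>\<^sub>1,\<dots>,\<surd>\<xi>\<^sub>m]\<close>, whose variables are the \<open>\<surd>\<xi>\<^sub>i\<close>.\<close>

type_synonym 'm mpoly = "('m \<Rightarrow>\<^sub>0 nat) \<Rightarrow>\<^sub>0 int"

definition var :: "'m \<Rightarrow> 'm mpoly" where
  "var i = Poly_Mapping.single (Poly_Mapping.single i 1) 1"

abbreviation sqrt_xi :: "'m \<Rightarrow> 'm mpoly" where
  "sqrt_xi \<equiv> var"

definition xi_form :: "int ^ 'm :: finite \<Rightarrow> 'm mpoly" where
  "xi_form a = (\<Sum>i\<in>UNIV. of_int (a $ i) * sqrt_xi i ^ 2)"

text \<open>\<open>\<surd>(\<xi>\<^sub>i\<xi>\<^sub>j)\<close> for a generator \<open>e\<^sub>i - e\<^sub>j\<close> or \<open>(-e\<^sub>i-e\<^sub>j)\<tau>\<close>.\<close>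

definition sqrt_mark :: "'m :: finite elt \<Rightarrow> 'm mpoly" where
  "sqrt_mark x = (THE p. \<exists>i j. i \<noteq> j \<and> (x = Black (e i - e j) \<or> x = Red (- e i - e j)) \<and>
                           p = sqrt_xi i * sqrt_xi j)"

fun edge_coeff :: "'m :: finite elt \<Rightarrow> 'm elt \<Rightarrow> 'm mpoly" where
  "edge_coeff (Black a) (Black b) = 2"
| "edge_coeff (Red a) (Red b) = - 2"
| "edge_coeff (Black a) (Red b) = - 2"
| "edge_coeff (Red b) (Black a) = 2"

fun diag_entry :: "'m :: finite elt \<Rightarrow> 'm mpoly" where
  "diag_entry (Black a) = - xi_form a"
| "diag_entry (Red a) = xi_form a"

text \<open>The mark of an edge from \<open>u\<close> to \<open>v\<close> can only be \<open>vu\<^sup>-\<^sup>1\<close>.\<close>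

definition entry :: "'m :: finite elt \<Rightarrow> 'm elt \<Rightarrow> 'm mpoly" where
  "entry u v =
     (if u = v then diag_entry u
      else if \<exists>x. marked_edge x u v then edge_coeff u v * sqrt_mark (v \<otimes>\<^sub>G ginv u)
      else 0)"

definition matrix_of_list :: "'m :: finite elt list \<Rightarrow> 'm mpoly Matrix.mat" where
  "matrix_of_list vs = Matrix.mat (length vs) (length vs) (\<lambda>(i, j). entry (vs ! i) (vs ! j))"

text \<open>The characteristic polynomial, in \<open>\<int>[\<surd>\<xi>\<^sub>1,\<dots>,\<surd>\<xi>\<^sub>m][t]\<close>. It does not depend on the
  enumeration; see \<open>chi_eq\<close> below.\<close>

definition chi :: "'m :: finite elt set \<Rightarrow> 'm mpoly poly" where
  "chi A = char_poly (matrix_of_list (SOME vs. distinct vs \<and> set vs = A))"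

text \<open>The inclusion \<open>\<int>[\<xi>\<^sub>1,\<dots>,\<xi>\<^sub>m] \<rightarrow> \<int>[\<surd>\<xi>\<^sub>1,\<dots>,\<surd>\<xi>\<^sub>m]\<close>, which sends each variable to the
  square of the corresponding variable, i.e. doubles all exponents.\<close>

definition sq_vars :: "'m mpoly \<Rightarrow> 'm mpoly" where
  "sq_vars p = (\<Sum>k\<in>Poly_Mapping.keys p. Poly_Mapping.single (k + k) (Poly_Mapping.lookup p k))"

section \<open>Well-definedness\<close>

lemma axis_nth: "e i $ k = (if k = i then 1 else 0)"
  by (simp add: axis_def)

lemma sqrt_mark_Black:
  assumes "i \<noteq> j"
  shows "sqrt_mark (Black (e i - e j)) = sqrt_xi i * sqrt_xi j"
  unfolding sqrt_mark_def
proof (rule the_equality)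
  show "\<exists>k l. k \<noteq> l \<and> (Black (e i - e j) = Black (e k - e l) \<or> Black (e i - e j) = Red (- e k - e l)) \<and>
          sqrt_xi i * sqrt_xi j = sqrt_xi k * sqrt_xi l"
    using assms by blast
  fix p
  assume "\<exists>k l. k \<noteq> l \<and> (Black (e i - e j) = Black (e k - e l) \<or> Black (e i - e j) = Red (- e k - e l)) \<and>
            p = sqrt_xi k * sqrt_xi l"
  then obtain k l where kl: "k \<noteq> l" "e i - e j = e k - e l" and p: "p = sqrt_xi k * sqrt_xi l"
    by auto
  have "(e i - e j) $ i = (e k - e l) $ i" "(e i - e j) $ j = (e k - e l) $ j"
    using kl(2) by simp_all
  with assms kl(1) have "i = k" "j = l"
    by (auto simp: axis_nth split: if_splits)
  with p show "p = sqrt_xi i * sqrt_xi j" by simp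
qed

lemma sqrt_mark_Red:
  assumes "i \<noteq> j"
  shows "sqrt_mark (Red (- e i - e j)) = sqrt_xi i * sqrt_xi j"
  unfolding sqrt_mark_def
proof (rule the_equality)
  show "\<exists>k l. k \<noteq> l \<and> (Red (- e i - e j) = Black (e k - e l) \<or> Red (- e i - e j) = Red (- e k - e l)) \<and>
          sqrt_xi i * sqrt_xi j = sqrt_xi k * sqrt_xi l"
    using assms by blast
  fix p
  assume "\<exists>k l. k \<noteq> l \<and> (Red (- e i - e j) = Black (e k - e l) \<or> Red (- e i - e j) = Red (- e k - e l)) \<and>
            p = sqrt_xi k * sqrt_xi l"
  then obtain k l where kl: "k \<noteq> l" "- e i - e j = - e k - e l" and p: "p = sqrt_xi k * sqrt_xi l"
    by auto
  have "(- e i - e j) $ i = (- e k - e l) $ i" "(- e i - e j) $ j = (- e k - e l) $ j"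
    using kl(2) by simp_all
  with assms kl(1) have "i = k \<and> j = l \<or> i = l \<and> j = k"
    by (cases "k = i"; cases "k = j"; cases "l = i"; cases "l = j") (simp_all add: axis_nth)
  with p show "p = sqrt_xi i * sqrt_xi j" by (auto simp: mult.commute)
qed

lemma marked_edge_mark: "marked_edge x u v \<Longrightarrow> x = v \<otimes>\<^sub>G ginv u"
  unfolding marked_edge_def by (cases x; cases u) auto

lemma char_poly_permute:
  fixes M :: "'a :: comm_ring_1 Matrix.mat"
  assumes M: "M \<in> carrier_mat n n" and p: "p permutes {0..<n}"
  shows "char_poly (Matrix.mat n n (\<lambda>(i, j). M $$ (p i, p j))) = char_poly M"
proof -
  let ?C = "char_poly_matrix M"
  let ?R = "Matrix.mat n n (\<lambda>(i, j). ?C $$ (p i, j))"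
  let ?T = "Matrix.mat n n (\<lambda>(i, j). transpose_mat ?R $$ (p i, j))"
  have C: "?C \<in> carrier_mat n n" using M by simp
  have pn: "p i < n" if "i < n" for i
    using permutes_in_image[OF p, of i] that by simp
  have inj: "p i = p j \<longleftrightarrow> i = j" for i j
    using permutes_inj[OF p] by (auto dest: injD)
  have "char_poly_matrix (Matrix.mat n n (\<lambda>(i, j). M $$ (p i, p j))) = transpose_mat ?T"
    using M by (intro eq_matI) (auto simp: char_poly_matrix_def pn inj)
  then have "char_poly (Matrix.mat n n (\<lambda>(i, j). M $$ (p i, p j)))
      = Determinant.det (transpose_mat ?T)"
    by (simp add: char_poly_def)
  also have "\<dots> = Determinant.det ?T"
    by (rule Determinant.det_transpose[of _ n]) simp
  also have "\<dots> = signof p * Determinant.det (transpose_mat ?R)"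
    by (rule Determinant.det_permute_rows[OF _ p]) simp
  also have "Determinant.det (transpose_mat ?R) = Determinant.det ?R"
    by (rule Determinant.det_transpose[of _ n]) simp
  also have "\<dots> = signof p * Determinant.det ?C"
    by (rule Determinant.det_permute_rows[OF C p])
  finally show ?thesis
    by (simp add: char_poly_def sign_def)
qed

lemma chi_eq:
  assumes "distinct vs" "set vs = A"
  shows "chi A = char_poly (matrix_of_list vs)"
proof -
  define ws where "ws = (SOME vs. distinct vs \<and> set vs = A)"
  have ws: "distinct ws" "set ws = A"
    unfolding ws_def using someI[of "\<lambda>vs. distinct vs \<and> set vs = A" vs] assms by auto
  have "mset ws = mset vs"
    using ws assms set_eq_iff_mset_eq_distinct by blast
  then obtain p where p: "p permutes {..<length vs}" "permute_list p vs = ws"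
    by (rule mset_eq_permutation)
  have len: "length ws = length vs"
    using p(2) by auto
  have nth: "ws ! i = vs ! p i" if "i < length vs" for i
    using p that permute_list_nth by blast
  have pn: "p i < length vs" if "i < length vs" for i
    using permutes_in_image[OF p(1), of i] that by simp
  have M: "matrix_of_list vs \<in> carrier_mat (length vs) (length vs)"
    by (simp add: matrix_of_list_def)
  have "matrix_of_list ws =
      Matrix.mat (length vs) (length vs) (\<lambda>(i, j). matrix_of_list vs $$ (p i, p j))"
    by (intro eq_matI) (auto simp: matrix_of_list_def len nth pn)
  then have "char_poly (matrix_of_list ws) = char_poly (matrix_of_list vs)"
    using char_poly_permute[OF M] p(1) by (simp add: atLeast0LessThan)
  then show ?thesis
    by (simp add: chi_def ws_def)
qed

lemma sq_vars_superset:
  assumes "finite S" "Poly_Mapping.keys p \<subseteq> S"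
  shows "sq_vars p = (\<Sum>k\<in>S. Poly_Mapping.single (k + k) (Poly_Mapping.lookup p k))"
  unfolding sq_vars_def
  by (rule sum.mono_neutral_left) (use assms in \<open>auto simp: in_keys_iff\<close>)

lemma sq_vars_single:
  "sq_vars (Poly_Mapping.single k c) = Poly_Mapping.single (k + k) c"
  by (subst sq_vars_superset[of "{k}"]) auto

lemma sq_vars_zero: "sq_vars 0 = 0"
  by (simp add: sq_vars_def)

lemma sq_vars_one: "sq_vars 1 = 1"
  using sq_vars_single[of 0 1] by simp

lemma sq_vars_add: "sq_vars (p + q) = sq_vars p + sq_vars q"
proof -
  let ?S = "Poly_Mapping.keys p \<union> Poly_Mapping.keys q"
  have *: "sq_vars r = (\<Sum>k\<in>?S. Poly_Mapping.single (k + k) (Poly_Mapping.lookup r k))"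
    if "Poly_Mapping.keys r \<subseteq> ?S" for r
    using that by (intro sq_vars_superset) auto
  have "Poly_Mapping.keys (p + q) \<subseteq> ?S" by (rule Poly_Mapping.keys_add)
  then show ?thesis
    by (simp add: * lookup_add single_add sum.distrib)
qed

lemma sq_vars_sum: "sq_vars (sum f S) = (\<Sum>x\<in>S. sq_vars (f x))"
  by (induction S rule: infinite_finite_induct) (simp_all add: sq_vars_zero sq_vars_add)

lemma mpoly_sum_single:
  "p = (\<Sum>k\<in>Poly_Mapping.keys p. Poly_Mapping.single k (Poly_Mapping.lookup p k))"
  by (rule poly_mapping_eqI) (auto simp: lookup_sum lookup_single when_def in_keys_iff)

lemma sq_vars_mult: "sq_vars (p * q) = sq_vars p * sq_vars q"
proof -
  let ?s = "\<lambda>p k. Poly_Mapping.single k (Poly_Mapping.lookup p k)"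
  have "p * q = (\<Sum>k\<in>Poly_Mapping.keys p. \<Sum>l\<in>Poly_Mapping.keys q. ?s p k * ?s q l)"
    unfolding sum_product[symmetric]
    by (rule arg_cong2[where f = times]; rule mpoly_sum_single)
  then have "sq_vars (p * q) =
      (\<Sum>k\<in>Poly_Mapping.keys p. \<Sum>l\<in>Poly_Mapping.keys q. sq_vars (?s p k * ?s q l))"
    by (simp add: sq_vars_sum)
  also have "\<dots> = sq_vars p * sq_vars q"
    unfolding sq_vars_def[of p] sq_vars_def[of q] sum_product
    by (intro sum.cong refl) (simp add: mult_single sq_vars_single ac_simps)
  finally show ?thesis .
qed

lemma double_exponent_inj: "k + k = l + l \<longleftrightarrow> k = (l :: 'm \<Rightarrow>\<^sub>0 nat)"
proof
  assume "k + k = l + l"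
  then have "Poly_Mapping.lookup k i + Poly_Mapping.lookup k i =
      Poly_Mapping.lookup l i + Poly_Mapping.lookup l i" for i
    by (metis lookup_add)
  then have "Poly_Mapping.lookup k i = Poly_Mapping.lookup l i" for i
    by (metis add_self_div_2)
  then show "k = l" by (intro poly_mapping_eqI)
qed simp

lemma lookup_sq_vars: "Poly_Mapping.lookup (sq_vars p) (l + l) = Poly_Mapping.lookup p l"
  unfolding sq_vars_def
  by (auto simp: lookup_sum lookup_single when_def in_keys_iff double_exponent_inj)

lemma sq_vars_inj: "inj sq_vars"
  by (rule injI) (metis lookup_sq_vars poly_mapping_eqI)

lemma sq_vars_var: "sq_vars (var i) = sqrt_xi i ^ 2"
  by (simp add: var_def sq_vars_single power2_eq_square mult_single)

end

theory Submission
  imports Defs "HOL-Library.Z2" "HOL-Computational_Algebra.Fraction_Field"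
begin

text \<open>The argument is 2-adic. The off-diagonal entries of the matrix are divisible by 2, and its diagonal
  entries \<open>d\<^sub>v\<close> are linear forms which are pairwise distinct modulo 4. Hence all eigenvalues lie in
  the 2-adic completion of \<open>\<rat>(\<surd>\<xi>\<^sub>1,\<dots>,\<surd>\<xi>\<^sub>m)\<close>, and second order perturbation theory gives
  \<open>t\<^sub>v = d\<^sub>v + 4\<Sum>\<^sub>u c\<^sub>v\<^sub>uc\<^sub>u\<^sub>v/(d\<^sub>v - d\<^sub>u)\<close> modulo 16, where \<open>2c\<close> is the off-diagonal part of the matrix.
  A factor of the characteristic polynomial selects a set \<open>S\<close> of vertices, and its trace, a polynomial,
  is the sum of the \<open>t\<^sub>v\<close> over \<open>S\<close>. The contributions of the edges inside \<open>S\<close> cancel, so modulo 4 the sum of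
  the fractions \<open>\<plusminus>\<xi>\<^sub>i\<xi>\<^sub>j/(\<xi>\<^sub>i \<plusminus> \<xi>\<^sub>j)\<close> over the edges of the cut \<open>(S, A - S)\<close> is a polynomial. By
  non-degeneracy every denominator occurs at most once, so there is no such edge, and \<open>S\<close> is empty or
  all of the connected graph \<open>A\<close>.\<close>

section \<open>Perturbation of a diagonal matrix over a 2-adic valuation ring\<close>

text \<open>The obstacle is the denominators. Forms of adjacent vertices differ by a unit, but forms
  of other vertices may agree modulo 2, and dividing by their difference then costs a factor 2. This
  is affordable because such vertices are not adjacent and, by allowability, not joined by a path of
  length 2, so the second order contribution with the bad denominator vanishes. Congruence modulo 4
  is excluded because edge vectors have l1-norm at most 2: the torsion of the integer lattice modulo
  their span is killed by 2. The precision 16 comes from the last step. As \<xi>_k - \<xi>_l and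
  \<xi>_k + \<xi>_l agree modulo 2, the terms of two cut edges with these denominators can cancel
  modulo 2, so the cut sum is needed modulo 4, and it enters the trace with the factor 4. The
  completion is never constructed. Eigenvalues are replaced by elements at which the characteristic
  polynomial is divisible by a high power of 2, and interpolation distributes these between the two
  factors.\<close>

locale two_valuation =
  fixes R :: "'k :: field set"
  assumes one_R: "1 \<in> R"
    and add_R: "\<And>x y. x \<in> R \<Longrightarrow> y \<in> R \<Longrightarrow> x + y \<in> R"
    and uminus_R: "\<And>x. x \<in> R \<Longrightarrow> - x \<in> R"
    and mult_R: "\<And>x y. x \<in> R \<Longrightarrow> y \<in> R \<Longrightarrow> x * y \<in> R"
    and two_nonzero: "(2 :: 'k) \<noteq> 0"
    and half_R: "1 / 2 \<notin> R"
    and inverse_R: "\<And>x. x \<in> R \<Longrightarrow> x / 2 \<notin> R \<Longrightarrow> inverse x \<in> R"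
begin

text \<open>By the locale axioms \<open>R\<close> is a local ring with maximal ideal
  \<open>2R\<close>, and this is the ideal \<open>2^n R\<close>. It is described inside the field,
  so that membership makes sense for quotients.\<close>

definition pow_ideal :: "nat \<Rightarrow> 'k set" where
  "pow_ideal n = {x. x / 2 ^ n \<in> R}"

lemma pow_ideal_0: "pow_ideal 0 = R"
  by (simp add: pow_ideal_def)

lemma zero_R: "0 \<in> R"
  using add_R[OF one_R uminus_R[OF one_R]] by simp

lemma pow_ideal_zero: "0 \<in> pow_ideal n"
  by (simp add: pow_ideal_def zero_R)

lemma pow_ideal_add: "x \<in> pow_ideal n \<Longrightarrow> y \<in> pow_ideal n \<Longrightarrow> x + y \<in> pow_ideal n"
  by (simp add: pow_ideal_def add_divide_distrib add_R)

lemma pow_ideal_uminus: "x \<in> pow_ideal n \<Longrightarrow> - x \<in> pow_ideal n"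
  using uminus_R by (force simp: pow_ideal_def)

lemma pow_ideal_diff: "x \<in> pow_ideal n \<Longrightarrow> y \<in> pow_ideal n \<Longrightarrow> x - y \<in> pow_ideal n"
  using pow_ideal_add[of x n "- y"] pow_ideal_uminus by simp

lemma pow_ideal_mult:
  assumes "x \<in> pow_ideal m" "y \<in> pow_ideal n"
  shows "x * y \<in> pow_ideal (m + n)"
proof -
  have "x * y / 2 ^ (m + n) = (x / 2 ^ m) * (y / 2 ^ n)" by (simp add: power_add)
  then show ?thesis using assms mult_R unfolding pow_ideal_def by (metis mem_Collect_eq)
qed

lemma pow_ideal_mult_R: "x \<in> pow_ideal n \<Longrightarrow> y \<in> R \<Longrightarrow> x * y \<in> pow_ideal n"
  using pow_ideal_mult[of x n y 0] by (simp add: pow_ideal_0)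

lemma R_mult_pow_ideal: "y \<in> R \<Longrightarrow> x \<in> pow_ideal n \<Longrightarrow> y * x \<in> pow_ideal n"
  using pow_ideal_mult_R[of x n y] by (simp add: mult.commute)

lemma pow_ideal_sum: "(\<And>i. i \<in> S \<Longrightarrow> f i \<in> pow_ideal n) \<Longrightarrow> sum f S \<in> pow_ideal n"
  by (induction S rule: infinite_finite_induct) (simp_all add: pow_ideal_zero pow_ideal_add)

lemma sum_R: "(\<And>i. i \<in> S \<Longrightarrow> f i \<in> R) \<Longrightarrow> sum f S \<in> R"
  using pow_ideal_sum[of S f 0] by (simp add: pow_ideal_0)

lemma power_in_pow_ideal: "2 ^ n \<in> pow_ideal n"
proof -
  have "(2 :: 'k) ^ n / 2 ^ n = 1" using two_nonzero by (intro divide_self power_not_zero)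
  then show ?thesis unfolding pow_ideal_def using one_R by simp
qed

lemma two_power_R: "2 ^ n \<in> R"
proof (induction n)
  case 0 show ?case by (simp add: one_R)
next
  case (Suc n)
  have "2 ^ n + 2 ^ n \<in> R" using add_R[OF Suc Suc] .
  then show ?case by (simp only: power_Suc mult_2)
qed

lemma pow_ideal_antimono:
  assumes "m \<le> n" "x \<in> pow_ideal n" shows "x \<in> pow_ideal m"
proof -
  obtain k where n: "n = m + k" using assms(1) le_Suc_ex by blast
  have "x / 2 ^ m = (x / 2 ^ n) * 2 ^ k" using two_nonzero by (simp add: n power_add)
  then show ?thesis using assms(2) two_power_R mult_R unfolding pow_ideal_def
    by (metis mem_Collect_eq)
qed

lemma pow_ideal_R: "x \<in> pow_ideal n \<Longrightarrow> x \<in> R"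
  using pow_ideal_antimono[of 0 n x] by (simp add: pow_ideal_0)

lemma two_mult_pow_ideal: "x \<in> pow_ideal n \<Longrightarrow> 2 * x \<in> pow_ideal (Suc n)"
  using two_nonzero by (simp add: pow_ideal_def)

lemma two_mult_pow_ideal_iff: "2 * x \<in> pow_ideal (Suc n) \<longleftrightarrow> x \<in> pow_ideal n"
  using two_nonzero by (simp add: pow_ideal_def)

lemma power_mult_pow_ideal: "x \<in> pow_ideal n \<Longrightarrow> 2 ^ k * x \<in> pow_ideal (n + k)"
  using pow_ideal_mult[OF power_in_pow_ideal[of k]] unfolding add.commute[of n k] .

lemma four_mult_pow_ideal: "x \<in> pow_ideal n \<Longrightarrow> 4 * x \<in> pow_ideal (Suc (Suc n))"
  using power_mult_pow_ideal[of x n 2] by simp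

lemma eight_mult_pow_ideal: "x \<in> pow_ideal n \<Longrightarrow> 8 * x \<in> pow_ideal (Suc (Suc (Suc n)))"
  using power_mult_pow_ideal[of x n 3] by (simp add: numeral_3_eq_3)

lemma half_pow_ideal: "x \<in> pow_ideal (Suc n) \<Longrightarrow> x / 2 \<in> pow_ideal n"
  by (simp add: pow_ideal_def)

lemma one_notin_pow_ideal: "n > 0 \<Longrightarrow> 1 \<notin> pow_ideal n"
  using pow_ideal_antimono[of 1 n 1] half_R by (auto simp: pow_ideal_def)

lemma pow_ideal_divide: "x \<in> pow_ideal n \<Longrightarrow> y \<in> R \<Longrightarrow> y \<notin> pow_ideal 1 \<Longrightarrow> x / y \<in> pow_ideal n"
  using pow_ideal_mult_R[of x n "inverse y"] inverse_R[of y]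
  by (simp add: pow_ideal_def field_simps)

lemma pow_ideal_divide2:
  assumes "x \<in> pow_ideal (Suc n)" "y \<in> pow_ideal 1" "y \<notin> pow_ideal 2"
  shows "x / y \<in> pow_ideal n"
proof -
  have "y / 2 \<in> R" "y / 2 \<notin> pow_ideal 1"
    using assms by (auto simp: pow_ideal_def power2_eq_square)
  from pow_ideal_divide[OF half_pow_ideal[OF assms(1)] this] show ?thesis
    using two_nonzero by simp
qed

text \<open>Factors 2 are taken out of \<open>x\<close> one at a time. If this stops early, what is
  left of \<open>x\<close> is a unit and \<open>y\<close> carries the whole remaining power.\<close>

lemma pow_ideal_prime:
  assumes "x \<in> R" "y \<in> R" "x * y \<in> pow_ideal (a + b)"
  shows "x \<in> pow_ideal a \<or> y \<in> pow_ideal b"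
  using assms
proof (induction a arbitrary: x)
  case 0 then show ?case by (simp add: pow_ideal_0)
next
  case (Suc a)
  show ?case
  proof (cases "x \<in> pow_ideal 1")
    case True
    have "(x / 2) * y \<in> pow_ideal (a + b)"
      using half_pow_ideal[of "x * y" "a + b"] Suc.prems(3) by simp
    moreover have "x / 2 \<in> R" using True by (simp add: pow_ideal_def)
    ultimately have "x / 2 \<in> pow_ideal a \<or> y \<in> pow_ideal b"
      using Suc.IH Suc.prems(2) by blast
    then show ?thesis using two_mult_pow_ideal[of "x / 2" a] two_nonzero by auto
  next
    case False
    then have "x * y / x \<in> pow_ideal (Suc a + b)"
      using pow_ideal_divide Suc.prems by blast
    moreover have "x \<noteq> 0" using False pow_ideal_zero by auto
    ultimately show ?thesis using pow_ideal_antimono[of b "Suc a + b" y] by simp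
  qed
qed

section \<open>Interpolation and approximate roots of factors\<close>

lemma poly_R:
  assumes "\<And>k. coeff p k \<in> R" "x \<in> R" shows "poly p x \<in> R"
proof -
  have "x ^ k \<in> R" for k by (induction k) (use one_R mult_R assms(2) in auto)
  then show ?thesis unfolding poly_altdef using assms(1) by (intro sum_R mult_R) auto
qed

text \<open>Newton interpolation: splitting off the node \<open>T a\<close> replaces values by
  difference quotients. As \<open>T v - T a\<close> is a unit or twice a unit, each node costs at
  most one factor 2.\<close>

lemma coeff_small_if_values_small:
  assumes "finite S" "degree f < card S"
    and "\<And>v. v \<in> S \<Longrightarrow> T v \<in> R"
    and "\<And>v w. v \<in> S \<Longrightarrow> w \<in> S \<Longrightarrow> v \<noteq> w \<Longrightarrow> T v - T w \<notin> pow_ideal 2"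
    and "\<And>v. v \<in> S \<Longrightarrow> poly f (T v) \<in> pow_ideal (h + card S)"
  shows "coeff f k \<in> pow_ideal h"
  using assms
proof (induction S arbitrary: f k rule: finite_induct)
  case (insert a S)
  define g where "g = synthetic_div f (T a)"
  have f: "f = [:- T a, 1:] * g + [:poly f (T a):]"
    unfolding g_def by (rule synthetic_div_correct'[symmetric])
  have fa: "poly f (T a) \<in> pow_ideal h"
    using insert.prems(4)[of a] pow_ideal_antimono[of h "h + card (insert a S)"] by simp
  have "coeff g k \<in> pow_ideal h" for k
  proof (cases "S = {}")
    case True
    then have "g = 0" using insert.prems(1) by (simp add: g_def synthetic_div_eq_0_iff)
    then show ?thesis by (simp add: pow_ideal_zero)
  next
    case False
    then have "card S > 0" using insert.hyps by (simp add: card_gt_0_iff)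
    then have "degree g < card S"
      using insert.prems(1) insert.hyps by (simp add: g_def degree_synthetic_div)
    moreover have "poly g (T v) \<in> pow_ideal (h + card S)" if v: "v \<in> S" for v
    proof -
      have neq: "v \<noteq> a" using v insert.hyps by auto
      have sep: "T v - T a \<notin> pow_ideal 2" using insert.prems(3)[of v a] v neq by simp
      then have nz: "T v - T a \<noteq> 0" using pow_ideal_zero by metis
      have "poly f (T v) = (T v - T a) * poly g (T v) + poly f (T a)"
        by (subst (1) f) (simp add: algebra_simps)
      then have "poly g (T v) = (poly f (T v) - poly f (T a)) / (T v - T a)"
        using nz by (simp add: field_simps)
      moreover have "poly f (T v) - poly f (T a) \<in> pow_ideal (Suc (h + card S))"
        using insert.prems(4)[of v] insert.prems(4)[of a] v insert.hyps pow_ideal_diff by simp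
      moreover have "T v - T a \<in> R"
        using insert.prems(2)[of v] insert.prems(2)[of a] v pow_ideal_diff[of _ 0]
        by (simp add: pow_ideal_0)
      ultimately show ?thesis
        using sep pow_ideal_divide2 pow_ideal_divide pow_ideal_antimono[of "h + card S" "Suc (h + card S)"]
        by (metis Suc_n_not_le_n nat_le_linear)
    qed
    ultimately show ?thesis
      using insert.IH insert.prems(2,3) by blast
  qed
  moreover have "T a \<in> R" using insert.prems(2) by simp
  moreover have "coeff f k = coeff (pCons 0 g) k - T a * coeff g k + coeff [:poly f (T a):] k"
    by (subst (1) f) simp
  ultimately show ?case
    using fa pow_ideal_zero
    by (auto simp: coeff_pCons split: nat.splits
        intro!: pow_ideal_add pow_ideal_diff R_mult_pow_ideal pow_ideal_uminus)
qed simp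

lemma prod_linear_factors:
  fixes T :: "'v \<Rightarrow> 'a :: idom"
  assumes "finite S"
  shows "degree (\<Prod>v\<in>S. [:- T v, 1:]) = card S \<and> lead_coeff (\<Prod>v\<in>S. [:- T v, 1:]) = 1 \<and>
    (S \<noteq> {} \<longrightarrow> coeff (\<Prod>v\<in>S. [:- T v, 1:]) (card S - 1) = - sum T S)"
  using assms
proof (induction S rule: finite_induct)
  case (insert a S)
  let ?g = "\<Prod>v\<in>S. [:- T v, 1:]"
  have g: "degree ?g = card S" "lead_coeff ?g = 1" "S \<noteq> {} \<Longrightarrow> coeff ?g (card S - 1) = - sum T S"
    using insert.IH by auto
  then have "?g \<noteq> 0" by auto
  then have "degree (\<Prod>v\<in>insert a S. [:- T v, 1:]) = card (insert a S)"
    using insert.hyps g(1) by (simp add: degree_mult_eq del: mult_pCons_left)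
  moreover have "lead_coeff (\<Prod>v\<in>insert a S. [:- T v, 1:]) = 1"
    using insert.hyps g(2) by (simp add: lead_coeff_mult del: mult_pCons_left)
  moreover have "coeff ([:- T a, 1:] * ?g) (card S) = - sum T (insert a S)"
    using insert.hyps g by (cases "S = {}") (auto simp: coeff_pCons split: nat.splits)
  ultimately show ?case using insert.hyps by (simp del: mult_pCons_left)
qed simp

text \<open>By \<open>pow_ideal_prime\<close> every \<open>T v\<close> is an approximate root of
  \<open>p\<close> or of \<open>q\<close>. Neither factor can have more of them than its degree,
  since interpolation would make the leading coefficient 1 even; counting leaves exactly
  \<open>degree p\<close> for \<open>p\<close>. The trace comes from comparing \<open>p\<close> with
  the product of the corresponding linear factors. The exponent \<open>N + 4\<close> pays for up to
  \<open>N\<close> nodes and leaves a congruence modulo 16; it is doubled because two factors share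
  it.\<close>

lemma split_roots_of_factors:
  fixes T :: "nat \<Rightarrow> 'k"
  assumes monic: "lead_coeff p = 1" "lead_coeff q = 1" and N: "degree p + degree q = N"
    and R: "\<And>k. coeff p k \<in> R" "\<And>k. coeff q k \<in> R" "\<And>v. v < N \<Longrightarrow> T v \<in> R"
    and sep: "\<And>v w. v < N \<Longrightarrow> w < N \<Longrightarrow> v \<noteq> w \<Longrightarrow> T v - T w \<notin> pow_ideal 2"
    and small: "\<And>v. v < N \<Longrightarrow> poly (p * q) (T v) \<in> pow_ideal ((N + 4) + (N + 4))"
    and p: "degree p > 0"
  shows "\<exists>S\<subseteq>{..<N}. card S = degree p \<and> coeff p (degree p - 1) + sum T S \<in> pow_ideal 4"
proof -
  define Z where "Z f = {v. v < N \<and> poly f (T v) \<in> pow_ideal (N + 4)}" for f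
  have fin: "finite (Z f)" and sub: "Z f \<subseteq> {..<N}" for f by (auto simp: Z_def)
  have card_Z: "card (Z f) \<le> degree f" if "lead_coeff f = 1" "degree f \<le> N" for f
  proof (rule ccontr)
    assume "\<not> card (Z f) \<le> degree f"
    then obtain S where S: "S \<subseteq> Z f" "card S = Suc (degree f)"
      by (meson not_less_eq_eq obtain_subset_with_card_n)
    \<comment> \<open>Allowing for \<open>N + 1\<close> nodes leaves 3 of the \<open>N + 4\<close>
      powers; any positive exponent would contradict the leading coefficient 1.\<close>
    have "coeff f (degree f) \<in> pow_ideal 3"
    proof (rule coeff_small_if_values_small[of S f T])
      show "poly f (T v) \<in> pow_ideal (3 + card S)" if "v \<in> S" for v
        using that S \<open>degree f \<le> N\<close> pow_ideal_antimono[of "3 + card S" "N + 4"]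
        by (auto simp: Z_def)
      show "finite S" using finite_subset[OF S(1) fin] .
      show "T v - T w \<notin> pow_ideal 2" if "v \<in> S" "w \<in> S" "v \<noteq> w" for v w
        using that S(1) sep by (auto simp: Z_def)
    qed (use S R(3) in \<open>auto simp: Z_def\<close>)
    then show False using that(1) one_notin_pow_ideal[of 3] by simp
  qed
  have "poly p (T v) \<in> pow_ideal (N + 4) \<or> poly q (T v) \<in> pow_ideal (N + 4)" if "v < N" for v
    using pow_ideal_prime[of "poly p (T v)" "poly q (T v)"] small[OF that] R that
    by (simp add: poly_R)
  then have "Z p \<union> Z q = {..<N}" by (auto simp: Z_def)
  then have "N \<le> card (Z p) + card (Z q)" using card_Un_le[of "Z p" "Z q"] by simp
  then have card: "card (Z p) = degree p"
    using card_Z[OF monic(1)] card_Z[OF monic(2)] N by linarith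
  then have ne: "Z p \<noteq> {}" using p by auto
  define G where "G = (\<Prod>v\<in>Z p. [:- T v, 1:])"
  have G: "degree G = degree p" "lead_coeff G = 1" "coeff G (degree p - 1) = - sum T (Z p)"
    using prod_linear_factors[OF fin, of T p] card ne by (auto simp: G_def)
  have "coeff (p - G) (degree p - 1) \<in> pow_ideal 4"
  proof (rule coeff_small_if_values_small[of "Z p" _ T])
    have "degree (p - G) \<le> degree p" using degree_diff_le[of p "degree p" G] G by simp
    moreover have "coeff (p - G) (degree p) = 0" using G monic by simp
    ultimately have "degree (p - G) \<noteq> degree p \<or> p - G = 0" using leading_coeff_0_iff by metis
    then show "degree (p - G) < card (Z p)" using \<open>degree (p - G) \<le> degree p\<close> card p by auto
    fix v assume v: "v \<in> Z p"
    then have "poly G (T v) = 0" unfolding G_def poly_prod using fin by (auto intro: prod_zero)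
    moreover have "4 + card (Z p) \<le> N + 4" using card N by simp
    ultimately show "poly (p - G) (T v) \<in> pow_ideal (4 + card (Z p))"
      using v pow_ideal_antimono[of "4 + card (Z p)" "N + 4" "poly p (T v)"] by (simp add: Z_def)
  qed (use R(3) sep fin in \<open>auto simp: Z_def\<close>)
  then show ?thesis using G(3) card sub by (intro exI[of _ "Z p"]) auto
qed

end

text \<open>The off-diagonal part is \<open>2c\<close>. \<open>separated_edge\<close> makes the
  second order terms integral. \<open>separated_path\<close> removes the second order coupling of
  indices whose diagonal entries agree modulo 2. \<open>c_triangle\<close> makes the third order
  correction of an eigenvalue vanish modulo 16 instead of only modulo 8.\<close>

locale perturbed_diagonal = two_valuation R for R :: "'k :: field set" +
  fixes N :: nat and d :: "nat \<Rightarrow> 'k" and c :: "nat \<Rightarrow> nat \<Rightarrow> 'k"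
  assumes d_R: "\<And>u. u < N \<Longrightarrow> d u \<in> R"
    and c_R: "\<And>u w. u < N \<Longrightarrow> w < N \<Longrightarrow> c u w \<in> R"
    and c_diag: "\<And>u. u < N \<Longrightarrow> c u u = 0"
    and c_support: "\<And>u w. u < N \<Longrightarrow> w < N \<Longrightarrow> c u w = 0 \<Longrightarrow> c w u = 0"
    and c_triangle: "\<And>u v w. u < N \<Longrightarrow> v < N \<Longrightarrow> w < N \<Longrightarrow>
          c u v * c v w * c w u = c u w * c w v * c v u"
    and separated: "\<And>u w. u < N \<Longrightarrow> w < N \<Longrightarrow> u \<noteq> w \<Longrightarrow> d u - d w \<notin> pow_ideal 2"
    and separated_edge: "\<And>u w. u < N \<Longrightarrow> w < N \<Longrightarrow> c u w \<noteq> 0 \<Longrightarrow> d u - d w \<notin> pow_ideal 1"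
    and separated_path: "\<And>u v w. u < N \<Longrightarrow> v < N \<Longrightarrow> w < N \<Longrightarrow> u \<noteq> w \<Longrightarrow> c u v \<noteq> 0 \<Longrightarrow> c v w \<noteq> 0 \<Longrightarrow>
          d u - d w \<notin> pow_ideal 1"
begin

definition perturbed_matrix :: "'k Matrix.mat" where
  "perturbed_matrix = Matrix.mat N N (\<lambda>(i, j). if i = j then d i else 2 * c i j)"

text \<open>Second order perturbation coefficient at \<open>d v\<close>. The summand
  \<open>u = v\<close>, with denominator 0, vanishes by \<open>c_diag\<close>.\<close>

definition shift :: "nat \<Rightarrow> 'k" where
  "shift v = (\<Sum>u<N. c v u * c u v / (d v - d u))"

text \<open>Component \<open>u\<close> of \<open>(t - M) x\<close> for
  \<open>M = perturbed_matrix\<close>.\<close>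

definition residual :: "'k \<Rightarrow> (nat \<Rightarrow> 'k) \<Rightarrow> nat \<Rightarrow> 'k" where
  "residual t x u = (t - d u) * x u - 2 * (\<Sum>w<N. c u w * x w)"

definition near :: "nat \<Rightarrow> nat \<Rightarrow> bool" where
  "near v u \<longleftrightarrow> d v - d u \<in> pow_ideal 1"

text \<open>The rows of the indices \<open>u\<close> near \<open>v\<close> need one more power of 2, because there \<open>t - d u\<close> is divisible
  by 2 and solving for \<open>x u\<close> loses this factor.\<close>

definition approx_eigen :: "nat \<Rightarrow> nat \<Rightarrow> 'k \<Rightarrow> (nat \<Rightarrow> 'k) \<Rightarrow> bool" where
  "approx_eigen v n t x \<longleftrightarrow> t - (d v + 4 * shift v) \<in> pow_ideal 4 \<and> x v = 1 \<and>
     (\<forall>u<N. u \<noteq> v \<longrightarrow> x u \<in> pow_ideal 1) \<and>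
     (\<forall>u<N. residual t x u \<in> pow_ideal (if near v u then Suc n else n))"

lemma diff_R: "u < N \<Longrightarrow> v < N \<Longrightarrow> d u - d v \<in> R"
  using d_R pow_ideal_diff[of _ 0] by (simp add: pow_ideal_0)

lemma edge_quotient_R:
  assumes "u < N" "w < N" shows "c u w / (d u - d w) \<in> R" "c w u / (d u - d w) \<in> R"
proof -
  have "x / (d u - d w) \<in> R" if "x \<in> R" "c u w \<noteq> 0" for x
    using pow_ideal_divide[of x 0 "d u - d w"] that diff_R[OF assms] separated_edge[OF assms]
    by (simp add: pow_ideal_0)
  then show "c u w / (d u - d w) \<in> R" "c w u / (d u - d w) \<in> R"
    using c_R[OF assms] c_R[OF assms(2,1)] c_support[OF assms] zero_R by (cases "c u w = 0"; simp)+
qed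

lemma shift_R: "v < N \<Longrightarrow> shift v \<in> R"
  unfolding shift_def
proof (rule sum_R)
  fix u assume "v < N" "u \<in> {..<N}"
  then have "c v u * (c u v / (d v - d u)) \<in> R"
    using c_R edge_quotient_R(2)[of v u] by (intro mult_R) auto
  then show "c v u * c u v / (d v - d u) \<in> R" unfolding times_divide_eq_right .
qed

lemma near_edge: "v < N \<Longrightarrow> u < N \<Longrightarrow> w < N \<Longrightarrow> near v u \<Longrightarrow> near v w \<Longrightarrow> c u w = 0"
  using separated_edge[of u w] pow_ideal_diff[of "d v - d w" 1 "d v - d u"]
  by (auto simp: near_def)

text \<open>Modulo 4 the approximate eigenvalue is \<open>d v\<close>, so \<open>t - d u\<close> is
  as divisible as \<open>d v - d u\<close>: a unit far from \<open>v\<close>, twice a unit at the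
  other indices near \<open>v\<close>.\<close>

lemma eigen_diff:
  assumes "approx_eigen v n t x" "v < N" "u < N"
  shows "t - d u \<in> R" "t - d u - (d v - d u) \<in> pow_ideal 2"
    and "\<not> near v u \<Longrightarrow> t - d u \<notin> pow_ideal 1"
    and "near v u \<Longrightarrow> t - d u \<in> pow_ideal 1"
    and "u \<noteq> v \<Longrightarrow> t - d u \<notin> pow_ideal 2"
proof -
  have eq0: "t - d v = (t - (d v + 4 * shift v)) + 4 * shift v" by simp
  have "t - (d v + 4 * shift v) \<in> pow_ideal 2"
    using assms(1) pow_ideal_antimono[of 2 4] by (auto simp: approx_eigen_def)
  moreover have "4 * shift v \<in> pow_ideal 2"
    using four_mult_pow_ideal[of "shift v" 0] shift_R[OF assms(2)]
    by (simp add: pow_ideal_0 numeral_2_eq_2)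
  ultimately have tv: "t - d v \<in> pow_ideal 2" unfolding eq0 by (rule pow_ideal_add)
  then show "t - d u - (d v - d u) \<in> pow_ideal 2" by simp
  have tv1: "t - d v \<in> pow_ideal 1" using pow_ideal_antimono[of 1 2] tv by simp
  have eq: "t - d u = (t - d v) + (d v - d u)" "d v - d u = (t - d u) - (t - d v)" by simp_all
  show "t - d u \<in> R" using eq(1) add_R[OF pow_ideal_R[OF tv] diff_R[OF assms(2,3)]] by simp
  show "\<not> near v u \<Longrightarrow> t - d u \<notin> pow_ideal 1"
    unfolding near_def using eq(2) pow_ideal_diff[OF _ tv1] by metis
  show "near v u \<Longrightarrow> t - d u \<in> pow_ideal 1"
    unfolding near_def using eq(1) pow_ideal_add[OF tv1] by metis
  show "u \<noteq> v \<Longrightarrow> t - d u \<notin> pow_ideal 2"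
    using separated[of v u] assms(2,3) eq(2) pow_ideal_diff[OF _ tv] by metis
qed

lemma residual_diff:
  "residual t' x' u = residual t x u + (t - d u) * (x' u - x u) + (t' - t) * x' u
     - 2 * (\<Sum>w<N. c u w * (x' w - x w))"
  unfolding residual_def by (simp add: algebra_simps sum_subtractf)

text \<open>Newton iteration: first the components far from \<open>v\<close> are corrected, then those near \<open>v\<close>, which are
  not adjacent to each other, together with the eigenvalue.\<close>

lemma approx_eigen_Suc:
  assumes v: "v < N" and n: "n \<ge> 3" and ap: "approx_eigen v n t x"
  shows "\<exists>t x. approx_eigen v (Suc n) t x"
proof -
  note ed = eigen_diff[OF ap v]
  have res: "residual t x u \<in> pow_ideal (if near v u then Suc n else n)" if "u < N" for u
    using ap that by (auto simp: approx_eigen_def)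
  have xv: "x v = 1" and x1: "\<And>u. u < N \<Longrightarrow> u \<noteq> v \<Longrightarrow> x u \<in> pow_ideal 1"
    and tv: "t - (d v + 4 * shift v) \<in> pow_ideal 4"
    using ap by (auto simp: approx_eigen_def)
  have near_v: "near v v" by (simp add: near_def pow_ideal_zero)
  \<comment> \<open>Far from \<open>v\<close> the divisor is a unit. The correction cancels the
    residual of row \<open>u\<close> up to the feedback through \<open>2c\<close>, which gains a
    power of 2.\<close>
  define x' where "x' u = (if near v u then x u else x u - residual t x u / (t - d u))" for u
  have x'_x: "x' u - x u \<in> pow_ideal n" if "u < N" for u
    using pow_ideal_divide[OF _ ed(1)[OF that] ed(3)[OF that]] res[OF that]
      pow_ideal_uminus pow_ideal_zero by (auto simp: x'_def)
  have x'1: "x' u \<in> pow_ideal 1" if "u < N" "u \<noteq> v" for u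
    using pow_ideal_add[OF x1[OF that] pow_ideal_antimono[OF _ x'_x[OF that(1)], of 1]] n by simp
  have sum2: "2 * (\<Sum>w<N. c u w * y w) \<in> pow_ideal (Suc k)"
    if "u < N" "\<And>w. w < N \<Longrightarrow> y w \<in> pow_ideal k" for u y k
    using that by (intro two_mult_pow_ideal pow_ideal_sum R_mult_pow_ideal c_R) auto
  have res': "residual t x' u \<in> pow_ideal (Suc n)" if u: "u < N" for u
  proof -
    have "residual t x u + (t - d u) * (x' u - x u) \<in> pow_ideal (Suc n)"
    proof (cases "near v u")
      case True then show ?thesis using res[OF u] by (simp add: x'_def)
    next
      case False
      then have "t - d u \<noteq> 0" using ed(3)[OF u] pow_ideal_zero by auto
      then show ?thesis using False by (simp add: x'_def pow_ideal_zero)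
    qed
    then show ?thesis
      unfolding residual_diff[of t x' u t x] using sum2[OF u x'_x] pow_ideal_diff by simp
  qed
  \<comment> \<open>As \<open>x' v = 1\<close>, this makes row \<open>v\<close> vanish exactly. The
    change lies in \<open>2^(n+1) R\<close> and \<open>n \<ge> 3\<close>, so \<open>t\<close> stays
    the same modulo 16.\<close>
  define t' where "t' = t - residual t x' v"
  define x'' where "x'' u = (if near v u \<and> u \<noteq> v then x' u - residual t x' u / (t - d u) else x' u)" for u
  have t'_t: "t' - t \<in> pow_ideal (Suc n)"
    using res'[OF v] pow_ideal_uminus by (simp add: t'_def)
  have x''_x': "x'' u - x' u \<in> pow_ideal n" if "u < N" for u
    using pow_ideal_divide2[OF res'[OF that] ed(4)[OF that] ed(5)[OF that]]
      pow_ideal_uminus pow_ideal_zero by (auto simp: x''_def)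
  have x''1: "x'' u \<in> pow_ideal 1" if "u < N" "u \<noteq> v" for u
    using pow_ideal_add[OF x'1[OF that] pow_ideal_antimono[OF _ x''_x'[OF that(1)], of 1]] n by simp
  have x''v: "x'' v = 1" "x' v = 1" using xv near_v by (simp_all add: x''_def x'_def)
  have res'': "residual t' x'' u \<in> pow_ideal (if near v u then Suc (Suc n) else Suc n)"
    if u: "u < N" for u
  proof (cases "near v u")
    case False
    have "(t' - t) * x'' u \<in> pow_ideal (Suc n)"
      using pow_ideal_mult_R[OF t'_t] x''1[OF u] pow_ideal_R x''v t'_t by (cases "u = v") auto
    moreover have "x'' u = x' u" using False by (simp add: x''_def)
    ultimately show ?thesis
      unfolding residual_diff[of t' x'' u t x'] using False sum2[OF u x''_x'] res'[OF u]
      by (simp add: pow_ideal_add pow_ideal_diff)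
  next
    case True
    \<comment> \<open>Only components near \<open>v\<close> have changed, and \<open>u\<close> is
      near \<open>v\<close> too, so \<open>near_edge\<close> kills each product: there is no
      feedback.\<close>
    have sum0: "(\<Sum>w<N. c u w * (x'' w - x' w)) = 0"
    proof (rule sum.neutral, intro ballI)
      fix w assume "w \<in> {..<N}"
      then show "c u w * (x'' w - x' w) = 0"
        using near_edge[OF v u _ True, of w] by (auto simp: x''_def)
    qed
    show ?thesis
    proof (cases "u = v")
      case eq: True
      show ?thesis unfolding residual_diff[of t' x'' u t x'] sum0 using eq x''v
        by (simp add: t'_def pow_ideal_zero)
    next
      case neq: False
      then have "t - d u \<noteq> 0" using ed(5)[OF u] pow_ideal_zero by auto
      \<comment> \<open>The extra power is that of \<open>x'' u\<close>, which is even for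
        \<open>u \<noteq> v\<close>.\<close>
      moreover have "(t' - t) * x'' u \<in> pow_ideal (Suc (Suc n))"
        using pow_ideal_mult[OF t'_t x''1[OF u neq]] by simp
      ultimately show ?thesis unfolding residual_diff[of t' x'' u t x'] sum0 using neq True
        by (simp add: x''_def)
    qed
  qed
  have "t' - (d v + 4 * shift v) \<in> pow_ideal 4"
  proof -
    have "t' - (d v + 4 * shift v) = (t' - t) + (t - (d v + 4 * shift v))" by simp
    moreover have "4 \<le> Suc n" using n by simp
    ultimately show ?thesis using pow_ideal_add[OF pow_ideal_antimono[OF _ t'_t, of 4] tv] by metis
  qed
  then have "approx_eigen v (Suc n) t' x''"
    unfolding approx_eigen_def using x''v x''1 res'' by auto
  then show ?thesis by blast
qed

text \<open>Closed walks of length 3 come in pairs with opposite orientation.\<close>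

lemma symmetric_sum_even:
  fixes g :: "nat \<Rightarrow> nat \<Rightarrow> 'k"
  assumes "\<And>i j. i < n \<Longrightarrow> j < n \<Longrightarrow> g i j \<in> R"
    and "\<And>i j. i < n \<Longrightarrow> j < n \<Longrightarrow> g i j = g j i"
    and "\<And>i. i < n \<Longrightarrow> g i i = 0"
  shows "(\<Sum>i<n. \<Sum>j<n. g i j) \<in> pow_ideal 1"
  using assms
proof (induction n)
  case 0 show ?case by (simp add: pow_ideal_zero)
next
  case (Suc n)
  have eq: "(\<Sum>i<n. g n i) = (\<Sum>i<n. g i n)"
    using Suc.prems(2) by (intro sum.cong) auto
  have "(\<Sum>i<Suc n. \<Sum>j<Suc n. g i j) = (\<Sum>i<n. \<Sum>j<n. g i j) + 2 * (\<Sum>i<n. g i n)"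
    using Suc.prems(3)[of n] eq by (simp add: sum.distrib)
  moreover have "2 * (\<Sum>i<n. g i n) \<in> pow_ideal 1"
    using two_mult_pow_ideal[of _ 0] sum_R[of "{..<n}" "\<lambda>i. g i n"] Suc.prems(1)
    by (simp add: pow_ideal_0)
  moreover have "(\<Sum>i<n. \<Sum>j<n. g i j) \<in> pow_ideal 1"
    using Suc.prems by (intro Suc.IH) auto
  ultimately show ?case using pow_ideal_add by simp
qed

text \<open>Perturbation expansion about the basis vector of \<open>v\<close>: \<open>a\<close> is
  the first order, \<open>y\<close> the second order far from \<open>v\<close>. At the other indices
  near \<open>v\<close> the second order source \<open>S a u\<close> is 0 by
  \<open>separated_path\<close>, so the first term that may survive is
  \<open>8 * S y u / (d v - d u)\<close>; the even denominator lowers it to \<open>4 * m u\<close>.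
  Row \<open>v\<close> is left with \<open>- 8 * S y v\<close>, where \<open>S y v\<close> is a sum
  over closed walks of length 3.\<close>

lemma approx_eigen_3:
  assumes v: "v < N"
  shows "\<exists>t x. approx_eigen v 3 t x"
proof -
  have near_v: "near v v" by (simp add: near_def pow_ideal_zero)
  define a where "a u = c u v / (d v - d u)" for u
  have a_R: "a u \<in> R" if "u < N" for u
    using edge_quotient_R(2)[OF v that] by (simp add: a_def)
  have a_near: "a u = 0" if "u < N" "near v u" for u
    using near_edge[OF v that(1) v that(2) near_v] by (simp add: a_def)
  define S where "S f u = (\<Sum>w<N. c u w * f w)" for f :: "nat \<Rightarrow> 'k" and u
  have S_R: "S f u \<in> R" if "u < N" "\<And>w. w < N \<Longrightarrow> f w \<in> R" for f u
    unfolding S_def using that by (intro sum_R mult_R c_R) auto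
  define y where "y u = (if near v u then 0 else S a u / (d v - d u))" for u
  have y_R: "y u \<in> R" if "u < N" for u
    using pow_ideal_divide[of "S a u" 0 "d v - d u"] S_R[OF that, of a] a_R diff_R[OF v that]
    by (auto simp: y_def zero_R pow_ideal_0 near_def)
  define m where "m u = (if near v u \<and> u \<noteq> v then 2 * S y u / (d v - d u) else 0)" for u
  have m_R: "m u \<in> R" if u: "u < N" for u
  proof (cases "near v u \<and> u \<noteq> v")
    case True
    have "2 * S y u \<in> pow_ideal (Suc 0)"
      using S_R[OF u, of y] y_R by (intro two_mult_pow_ideal) (simp add: pow_ideal_0)
    then show ?thesis
      using pow_ideal_divide2[of "2 * S y u" 0 "d v - d u"] True separated[OF v u]
      by (auto simp: m_def near_def pow_ideal_0)
  qed (auto simp: m_def zero_R)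
  define x where "x u = (if u = v then 1 else 0) + 2 * a u + 4 * y u + 4 * m u" for u
  define t where "t = d v + 4 * shift v"
  have xv: "x v = 1" using a_near[OF v near_v] near_v by (simp add: x_def y_def m_def)
  have x1: "x u \<in> pow_ideal 1" if u: "u < N" "u \<noteq> v" for u
  proof -
    have "x u = 2 * (a u + 2 * (y u + m u))" using u by (simp add: x_def algebra_simps)
    moreover have "a u + 2 * (y u + m u) \<in> R"
      using a_R y_R m_R u two_power_R[of 1] by (intro add_R mult_R) auto
    ultimately show ?thesis using two_mult_pow_ideal[of "a u + 2 * (y u + m u)" 0]
      by (simp only: pow_ideal_0 One_nat_def)
  qed
  have res: "residual t x u = (d v - d u + 4 * shift v) * x u - 2 * c u v - 4 * S a u - 8 * S y u - 8 * S m u"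
    if "u < N" for u
  proof -
    have "(\<Sum>w<N. c u w * x w) = (\<Sum>w<N. c u w * (if w = v then 1 else 0)) + 2 * S a u + 4 * S y u + 4 * S m u"
      unfolding S_def x_def by (simp add: algebra_simps sum.distrib sum_distrib_left)
    also have "(\<Sum>w<N. c u w * (if w = v then 1 else 0)) = c u v"
      using v by (simp add: if_distrib cong: if_cong)
    finally show ?thesis unfolding residual_def by (simp add: t_def algebra_simps)
  qed
  have Sm_near: "S m u = 0" if u: "u < N" "near v u" for u
    unfolding S_def
  proof (rule sum.neutral, intro ballI)
    fix w assume "w \<in> {..<N}"
    then show "c u w * m w = 0" using near_edge[OF v u(1) _ u(2), of w] by (auto simp: m_def)
  qed
  have "residual t x u \<in> pow_ideal (if near v u then Suc 3 else 3)" if u: "u < N" for u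
  proof -
    consider "u = v" | "near v u" "u \<noteq> v" | "\<not> near v u" by blast
    then show ?thesis
    proof cases
      case 1
      define g where "g w z = (c v w / (d v - d w)) * c w z * (c z v / (d v - d z))" for w z
      have "(\<Sum>w<N. \<Sum>z<N. g w z) \<in> pow_ideal 1"
      proof (rule symmetric_sum_even)
        fix w z assume wz: "w < N" "z < N"
        show "g w z \<in> R"
          unfolding g_def using edge_quotient_R[OF v] c_R wz by (intro mult_R) auto
        have "g w z = (c v w * c w z * c z v) / ((d v - d w) * (d v - d z))" by (simp add: g_def)
        also have "\<dots> = g z w" unfolding c_triangle[OF v wz] by (simp add: g_def)
        finally show "g w z = g z w" .
      qed (simp add: g_def c_diag)
      also have "(\<Sum>w<N. \<Sum>z<N. g w z) = S y v"
        unfolding S_def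
      proof (intro sum.cong refl)
        fix w assume w: "w \<in> {..<N}"
        show "(\<Sum>z<N. g w z) = c v w * y w"
        proof (cases "near v w")
          case True
          then have "c v w = 0" using near_edge[OF v v _ near_v, of w] w by auto
          then show ?thesis by (simp add: g_def)
        next
          case False
          have "(\<Sum>z<N. g w z) = (\<Sum>z<N. c v w * (c w z * a z / (d v - d w)))"
            by (intro sum.cong refl) (simp add: g_def a_def ac_simps)
          also have "\<dots> = c v w * (S a w / (d v - d w))"
            by (simp only: S_def sum_distrib_left sum_divide_distrib)
          finally show ?thesis using False by (simp add: y_def)
        qed
      qed
      finally have "8 * S y v \<in> pow_ideal (Suc 3)"
        using eight_mult_pow_ideal[of "S y v" 1] by (simp add: numeral_3_eq_3)
      moreover have "S a v = shift v" by (simp add: S_def shift_def a_def)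
      ultimately show ?thesis
        using 1 res[OF v] xv Sm_near[OF v near_v] c_diag[OF v] near_v pow_ideal_uminus by simp
    next
      case 2
      have "S a u = 0" unfolding S_def
      proof (rule sum.neutral, intro ballI)
        fix w assume w: "w \<in> {..<N}"
        have "c u w = 0 \<or> c w v = 0"
        proof (rule ccontr)
          assume "\<not> (c u w = 0 \<or> c w v = 0)"
          then have "d u - d v \<notin> pow_ideal 1" using separated_path[OF u _ v, of w] w 2 by auto
          then show False using 2 pow_ideal_uminus[of "d v - d u" 1] by (simp add: near_def)
        qed
        then show "c u w * a w = 0" by (auto simp: a_def)
      qed
      moreover have "c u v = 0" using near_edge[OF v u v 2(1) near_v] .
      moreover have "x u = 4 * m u" using 2 a_near[OF u] by (simp add: x_def y_def)
      moreover have "d v - d u \<noteq> 0" using separated[OF v u] 2 pow_ideal_zero by auto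
      then have "(d v - d u) * m u = 2 * S y u" using 2 by (simp add: m_def)
      moreover have "(d v - d u + 4 * shift v) * (4 * m u)
          = 4 * ((d v - d u) * m u) + 16 * (shift v * m u)"
        by (simp add: algebra_simps)
      ultimately have "residual t x u = 2 ^ 4 * (shift v * m u)"
        using res[OF u] Sm_near[OF u 2(1)] by simp
      moreover have "2 ^ 4 * (shift v * m u) \<in> pow_ideal (Suc 3)"
        using power_mult_pow_ideal[of "shift v * m u" 0 4] mult_R[OF shift_R[OF v] m_R[OF u]]
        by (simp add: pow_ideal_0)
      ultimately show ?thesis using 2 by simp
    next
      case 3
      then have "u \<noteq> v" "d v - d u \<noteq> 0" using near_v pow_ideal_zero by (auto simp: near_def)
      then have "(d v - d u) * a u = c u v" "(d v - d u) * y u = S a u" "x u = 2 * a u + 4 * y u"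
        using 3 by (simp_all add: a_def y_def x_def m_def)
      moreover have "(d v - d u + 4 * shift v) * (2 * a u + 4 * y u)
          = 2 * ((d v - d u) * a u) + 4 * ((d v - d u) * y u) + 8 * (shift v * (a u + 2 * y u))"
        by (simp add: algebra_simps)
      ultimately have "(d v - d u + 4 * shift v) * x u
          = 2 * c u v + 4 * S a u + 8 * (shift v * (a u + 2 * y u))"
        by simp
      then have "residual t x u = 2 ^ 3 * (shift v * (a u + 2 * y u) - S y u - S m u)"
        using res[OF u] by (simp add: algebra_simps)
      moreover have "shift v * (a u + 2 * y u) - S y u - S m u \<in> R"
        using shift_R[OF v] a_R[OF u] y_R two_power_R[of 1] S_R[OF u] m_R
        unfolding diff_conv_add_uminus by (intro add_R mult_R uminus_R) (auto simp: u)
      ultimately have "residual t x u \<in> pow_ideal 3"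
        using power_mult_pow_ideal[of "shift v * (a u + 2 * y u) - S y u - S m u" 0 3]
        unfolding pow_ideal_0 by (metis add_0)
      then show ?thesis using 3 by simp
    qed
  qed
  then have "approx_eigen v 3 t x"
    unfolding approx_eigen_def using xv x1 by (simp add: t_def pow_ideal_zero)
  then show ?thesis by blast
qed

lemma approx_eigen_exists:
  assumes "v < N" "n \<ge> 3" shows "\<exists>t x. approx_eigen v n t x"
  using assms(2)
proof (induction n rule: dec_induct)
  case base show ?case by (rule approx_eigen_3[OF assms(1)])
next
  case (step n) then show ?case using approx_eigen_Suc[OF assms(1)] by blast
qed

section \<open>From approximate eigenvectors to the traces of factors\<close>

lemma perturbed_matrix_carrier: "perturbed_matrix \<in> carrier_mat N N"
  by (simp add: perturbed_matrix_def)

lemma det_R: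
  assumes "A \<in> carrier_mat n n" "\<And>i j. i < n \<Longrightarrow> j < n \<Longrightarrow> A $$ (i, j) \<in> R"
  shows "Determinant.det A \<in> R"
  unfolding det_def'[OF assms(1)]
proof (rule sum_R)
  fix p assume p: "p \<in> {p. p permutes {0..<n}}"
  have "(\<Prod>i\<in>S. A $$ (i, p i)) \<in> R" if "S \<subseteq> {0..<n}" for S
    using that
  proof (induction S rule: infinite_finite_induct)
    case (insert i S)
    then show ?case using assms(2)[of i "p i"] permutes_in_image[of p "{0..<n}" i] p mult_R by auto
  qed (simp_all add: one_R)
  then show "signof p * (\<Prod>i = 0..<n. A $$ (i, p i)) \<in> R"
    using one_R uminus_R by (cases p rule: sign_cases) auto
qed

text \<open>Cramer's rule: multiplying \<open>B x = residual\<close> by the adjugate and reading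
  component \<open>v\<close>, where \<open>x v = 1\<close>, writes \<open>det B\<close> as a
  combination of residuals with cofactors in \<open>R\<close>.\<close>

lemma char_poly_approx_eigen:
  assumes v: "v < N" and ap: "approx_eigen v n t x"
  shows "poly (char_poly perturbed_matrix) t \<in> pow_ideal n"
proof -
  define B where "B = Matrix.mat N N (\<lambda>(i, j). (if i = j then t else 0) - perturbed_matrix $$ (i, j))"
  have B: "B \<in> carrier_mat N N" by (simp add: B_def)
  have t_R: "t \<in> R" using eigen_diff(1)[OF ap v v] d_R[OF v] add_R[of "t - d v" "d v"] by simp
  have B_R: "B $$ (i, j) \<in> R" if "i < N" "j < N" for i j
    using that t_R d_R c_R two_power_R[of 1] add_R[OF t_R uminus_R[OF d_R]]
      uminus_R[OF mult_R[OF two_power_R[of 1] c_R]]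
    by (auto simp: B_def perturbed_matrix_def)
  have poly_B: "poly (char_poly perturbed_matrix) t = Determinant.det B"
    unfolding char_poly_def
    by (rule poly_det_cong[of _ N]) (auto simp: B_def perturbed_matrix_def char_poly_matrix_def)
  let ?x = "Matrix.vec N x" and ?r = "Matrix.vec N (residual t x)"
  have Bx: "B *\<^sub>v ?x = ?r"
  proof (rule eq_vecI)
    fix u assume "u < dim_vec ?r"
    then have u: "u < N" by simp
    have "vec_index (B *\<^sub>v ?x) u = (\<Sum>w<N. B $$ (u, w) * x w)"
      using u B by (simp add: scalar_prod_def atLeast0LessThan)
    also have "\<dots> = (\<Sum>w<N. (if w = u then (t - d u) * x u else 0) - 2 * (c u w * x w))"
      by (intro sum.cong refl) (use u c_diag[OF u] in \<open>auto simp: B_def perturbed_matrix_def\<close>)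
    also have "\<dots> = residual t x u"
      using u by (simp add: residual_def sum_subtractf sum_distrib_left)
    finally show "vec_index (B *\<^sub>v ?x) u = vec_index ?r u" using u by simp
  qed (use B in simp)
  have "Determinant.det B \<cdot>\<^sub>v ?x = (Determinant.det B \<cdot>\<^sub>m 1\<^sub>m N) *\<^sub>v ?x"
    by (intro eq_vecI) (auto simp: scalar_prod_def if_distrib if_distribR cong: if_cong)
  also have "\<dots> = adj_mat B *\<^sub>v ?r"
    using assoc_mult_mat_vec[OF adj_mat(1)[OF B] B, of ?x] adj_mat(3)[OF B] Bx by simp
  finally have "vec_index (Determinant.det B \<cdot>\<^sub>v ?x) v = vec_index (adj_mat B *\<^sub>v ?r) v" by simp
  then have "Determinant.det B = (\<Sum>u<N. cofactor B u v * residual t x u)"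
    using v ap B adj_mat(1)[OF B]
    by (simp add: scalar_prod_def approx_eigen_def atLeast0LessThan adj_mat_def)
  also have "\<dots> \<in> pow_ideal n"
  proof (intro pow_ideal_sum R_mult_pow_ideal)
    fix u assume "u \<in> {..<N}"
    then have u: "u < N" by simp
    have "residual t x u \<in> pow_ideal (if near v u then Suc n else n)"
      using ap u by (simp add: approx_eigen_def)
    then show "residual t x u \<in> pow_ideal n" using pow_ideal_antimono[of n "Suc n"] by (auto split: if_splits)
    have "Determinant.det (mat_delete B u v) \<in> R"
      using B B_R by (intro det_R[of _ "N - 1"] mat_delete_carrier) (auto simp: mat_delete_def)
    moreover have "(-1) ^ k \<in> R" for k :: nat
      using one_R uminus_R by (cases "even k") auto
    ultimately show "cofactor B u v \<in> R" unfolding cofactor_def using mult_R by blast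
  qed
  finally show ?thesis unfolding poly_B .
qed

lemma factor_trace:
  assumes monic: "lead_coeff p = 1" "lead_coeff q = 1" and pq: "p * q = char_poly perturbed_matrix"
    and R: "\<And>k. coeff p k \<in> R" "\<And>k. coeff q k \<in> R" and p: "degree p > 0"
  shows "\<exists>S\<subseteq>{..<N}. card S = degree p \<and> coeff p (degree p - 1) + sum d S +
    4 * (\<Sum>v\<in>S. \<Sum>u\<in>{..<N} - S. c v u * c u v / (d v - d u)) \<in> pow_ideal 4"
proof -
  have "degree (p * q) = degree p + degree q"
    using monic by (intro degree_mult_eq) auto
  then have N: "degree p + degree q = N"
    using pq degree_monic_char_poly[OF perturbed_matrix_carrier] by simp
  have "\<exists>t x. approx_eigen v (N + 4 + (N + 4)) t x" if "v < N" for v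
    using approx_eigen_exists[OF that] by simp
  then obtain T X where T: "\<And>v. v < N \<Longrightarrow> approx_eigen v (N + 4 + (N + 4)) (T v) (X v)"
    by metis
  have T_shift: "T v - (d v + 4 * shift v) \<in> pow_ideal 4" if "v < N" for v
    using T[OF that] by (simp add: approx_eigen_def)
  have "\<exists>S\<subseteq>{..<N}. card S = degree p \<and> coeff p (degree p - 1) + sum T S \<in> pow_ideal 4"
  proof (rule split_roots_of_factors[OF monic N R])
    fix v assume v: "v < N"
    show "T v \<in> R" using add_R[OF eigen_diff(1)[OF T[OF v] v v] d_R[OF v]] by simp
    show "poly (p * q) (T v) \<in> pow_ideal (N + 4 + (N + 4))"
      unfolding pq by (rule char_poly_approx_eigen[OF v T[OF v]])
    fix w assume w: "w < N" "v \<noteq> w"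
    have eq: "T v - d w = (T v - T w) + (T w - d w)" by simp
    have "T w - d w \<in> pow_ideal 2" using eigen_diff(2)[OF T[OF w(1)] w(1) w(1)] by simp
    then show "T v - T w \<notin> pow_ideal 2"
      using eigen_diff(5)[OF T[OF v] v w(1)] w(2) pow_ideal_add unfolding eq by blast
  qed (use p in auto)
  then obtain S where S: "S \<subseteq> {..<N}" "card S = degree p"
    and tr: "coeff p (degree p - 1) + sum T S \<in> pow_ideal 4" by blast
  have fin: "finite S" using S(1) finite_subset by blast
  have "sum T S - (\<Sum>v\<in>S. d v + 4 * shift v) \<in> pow_ideal 4"
    unfolding sum_subtractf[symmetric] using S(1) T_shift by (intro pow_ideal_sum) auto
  from pow_ideal_diff[OF tr this]
  have "coeff p (degree p - 1) + sum d S + 4 * (\<Sum>v\<in>S. shift v) \<in> pow_ideal 4"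
    by (simp add: sum.distrib sum_distrib_left algebra_simps)
  also have "(\<Sum>v\<in>S. shift v) = (\<Sum>v\<in>S. \<Sum>u\<in>{..<N} - S. c v u * c u v / (d v - d u))"
  proof -
    let ?f = "\<lambda>v u. c v u * c u v / (d v - d u)"
    \<comment> \<open>The numerator is symmetric in \<open>v\<close> and \<open>u\<close>, the
      denominator antisymmetric.\<close>
    have "(\<Sum>v\<in>S. \<Sum>u\<in>S. ?f v u) = - (\<Sum>v\<in>S. \<Sum>u\<in>S. ?f u v)"
      unfolding sum_negf[symmetric]
    proof (intro sum.cong refl)
      fix v u
      have "d v - d u = - (d u - d v)" by simp
      then show "?f v u = - ?f u v" by (metis minus_divide_right mult.commute)
    qed
    also have "(\<Sum>v\<in>S. \<Sum>u\<in>S. ?f u v) = (\<Sum>v\<in>S. \<Sum>u\<in>S. ?f v u)"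
      by (rule sum.swap)
    finally have "2 * (\<Sum>v\<in>S. \<Sum>u\<in>S. ?f v u) = 0" by simp
    then have zero: "(\<Sum>v\<in>S. \<Sum>u\<in>S. ?f v u) = 0" using two_nonzero by simp
    have "(\<Sum>v\<in>S. shift v) = (\<Sum>v\<in>S. (\<Sum>u\<in>{..<N} - S. ?f v u) + (\<Sum>u\<in>S. ?f v u))"
      unfolding shift_def by (intro sum.cong refl sum.subset_diff S(1)) simp
    then show ?thesis using zero by (simp add: sum.distrib)
  qed
  finally show ?thesis using S by blast
qed

end

section \<open>Evaluation of polynomials and the 2-adic valuation\<close>

definition monomial_eval :: "('i \<Rightarrow> 'b :: comm_ring_1) \<Rightarrow> ('i \<Rightarrow>\<^sub>0 nat) \<Rightarrow> 'b" where
  "monomial_eval g k = (\<Prod>i\<in>Poly_Mapping.keys k. g i ^ Poly_Mapping.lookup k i)"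

definition mpoly_eval :: "('i \<Rightarrow> 'b :: comm_ring_1) \<Rightarrow> 'i mpoly \<Rightarrow> 'b" where
  "mpoly_eval g f =
     (\<Sum>k\<in>Poly_Mapping.keys f. of_int (Poly_Mapping.lookup f k) * monomial_eval g k)"

lemma monomial_eval_superset:
  assumes "finite S" "Poly_Mapping.keys k \<subseteq> S"
  shows "monomial_eval g k = (\<Prod>i\<in>S. g i ^ Poly_Mapping.lookup k i)"
  unfolding monomial_eval_def
  by (rule prod.mono_neutral_left) (use assms in \<open>auto simp: in_keys_iff\<close>)

lemma monomial_eval_zero [simp]: "monomial_eval g 0 = 1"
  by (simp add: monomial_eval_def)

lemma monomial_eval_add: "monomial_eval g (k + l) = monomial_eval g k * monomial_eval g l"
proof -
  let ?S = "Poly_Mapping.keys k \<union> Poly_Mapping.keys l"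
  have *: "monomial_eval g h = (\<Prod>i\<in>?S. g i ^ Poly_Mapping.lookup h i)"
    if "Poly_Mapping.keys h \<subseteq> ?S" for h
    using that by (intro monomial_eval_superset) auto
  have "Poly_Mapping.keys (k + l) \<subseteq> ?S" by (rule Poly_Mapping.keys_add)
  then show ?thesis by (simp add: * lookup_add power_add prod.distrib)
qed

lemma monomial_eval_single [simp]: "monomial_eval g (Poly_Mapping.single i n) = g i ^ n"
  by (simp add: monomial_eval_def)

lemma mpoly_eval_superset:
  assumes "finite S" "Poly_Mapping.keys f \<subseteq> S"
  shows "mpoly_eval g f = (\<Sum>k\<in>S. of_int (Poly_Mapping.lookup f k) * monomial_eval g k)"
  unfolding mpoly_eval_def
  by (rule sum.mono_neutral_left) (use assms in \<open>auto simp: in_keys_iff\<close>)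

lemma mpoly_eval_zero [simp]: "mpoly_eval g 0 = 0"
  by (simp add: mpoly_eval_def)

lemma mpoly_eval_single [simp]:
  "mpoly_eval g (Poly_Mapping.single k c) = of_int c * monomial_eval g k"
  by (subst mpoly_eval_superset[of "{k}"]) auto

lemma mpoly_eval_one [simp]: "mpoly_eval g 1 = 1"
  using mpoly_eval_single[of g 0 1] by simp

lemma mpoly_eval_add: "mpoly_eval g (p + q) = mpoly_eval g p + mpoly_eval g q"
proof -
  let ?S = "Poly_Mapping.keys p \<union> Poly_Mapping.keys q"
  have *: "mpoly_eval g r = (\<Sum>k\<in>?S. of_int (Poly_Mapping.lookup r k) * monomial_eval g k)"
    if "Poly_Mapping.keys r \<subseteq> ?S" for r
    using that by (intro mpoly_eval_superset) auto
  have "Poly_Mapping.keys (p + q) \<subseteq> ?S" by (rule Poly_Mapping.keys_add)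
  then show ?thesis by (simp add: * lookup_add algebra_simps sum.distrib)
qed

lemma mpoly_eval_sum: "mpoly_eval g (sum f S) = (\<Sum>x\<in>S. mpoly_eval g (f x))"
  by (induction S rule: infinite_finite_induct) (simp_all add: mpoly_eval_add)

lemma mpoly_eval_mult: "mpoly_eval g (p * q) = mpoly_eval g p * mpoly_eval g q"
proof -
  let ?s = "\<lambda>p k. Poly_Mapping.single k (Poly_Mapping.lookup p k)"
  have "p * q = (\<Sum>k\<in>Poly_Mapping.keys p. \<Sum>l\<in>Poly_Mapping.keys q. ?s p k * ?s q l)"
    unfolding sum_product[symmetric]
    by (rule arg_cong2[where f = times]; rule mpoly_sum_single)
  then have "mpoly_eval g (p * q) =
      (\<Sum>k\<in>Poly_Mapping.keys p. \<Sum>l\<in>Poly_Mapping.keys q. mpoly_eval g (?s p k * ?s q l))"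
    by (simp add: mpoly_eval_sum)
  also have "\<dots> = mpoly_eval g p * mpoly_eval g q"
    unfolding mpoly_eval_def[of g p] mpoly_eval_def[of g q] sum_product
    by (intro sum.cong refl) (simp add: mult_single monomial_eval_add ac_simps)
  finally show ?thesis .
qed

interpretation mpoly_eval: comm_ring_hom "mpoly_eval g" for g :: "'i \<Rightarrow> 'b :: comm_ring_1"
  by unfold_locales (simp_all add: mpoly_eval_add mpoly_eval_mult)

lemma mpoly_eval_var [simp]: "mpoly_eval g (var i) = g i"
  by (simp add: var_def)

lemma (in comm_ring_hom) hom_mpoly_eval: "hom (mpoly_eval g f) = mpoly_eval (\<lambda>i. hom (g i)) f"
  by (simp add: mpoly_eval_def monomial_eval_def hom_distribs)

text \<open>The coefficient ring is kept general: \<open>int\<close> serves for the identity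
  substitution, \<open>bit\<close> for reduction modulo 2.\<close>

lemma monomial_eval_var: "monomial_eval (\<lambda>i. Poly_Mapping.single (Poly_Mapping.single i 1) 1) k
   = Poly_Mapping.single k (1 :: 'b :: comm_ring_1)"
proof -
  have single_power: "Poly_Mapping.single (Poly_Mapping.single i (1 :: nat)) (1 :: 'b) ^ n
      = Poly_Mapping.single (Poly_Mapping.single i n) 1" for i n
    by (induction n) (simp_all add: mult_single flip: single_add)
  have "(\<Prod>i\<in>S. Poly_Mapping.single (Poly_Mapping.single i (Poly_Mapping.lookup k i)) (1 :: 'b))
      = Poly_Mapping.single (\<Sum>i\<in>S. Poly_Mapping.single i (Poly_Mapping.lookup k i)) 1" for S
    by (induction S rule: infinite_finite_induct) (simp_all add: mult_single)
  moreover have "k = (\<Sum>i\<in>Poly_Mapping.keys k. Poly_Mapping.single i (Poly_Mapping.lookup k i))"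
    by (rule poly_mapping_eqI) (auto simp: lookup_sum lookup_single when_def in_keys_iff)
  ultimately show ?thesis unfolding monomial_eval_def single_power by simp
qed

lemma mpoly_eval_id: "mpoly_eval var f = f"
proof -
  have "mpoly_eval var f = (\<Sum>k\<in>Poly_Mapping.keys f. Poly_Mapping.single k (Poly_Mapping.lookup f k))"
    unfolding mpoly_eval_def var_def
    by (simp only: monomial_eval_var) (simp add: mult_single flip: single_of_int)
  then show ?thesis using mpoly_sum_single[of f] by simp
qed

section \<open>Reduction modulo 2 and primality of 2\<close>

definition mod2 :: "'i mpoly \<Rightarrow> ('i \<Rightarrow>\<^sub>0 nat) \<Rightarrow>\<^sub>0 bit" where
  "mod2 = mpoly_eval (\<lambda>i. Poly_Mapping.single (Poly_Mapping.single i 1) 1)"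

interpretation mod2: comm_ring_hom mod2
  unfolding mod2_def by (rule mpoly_eval.comm_ring_hom_axioms)

lemma lookup_mod2: "Poly_Mapping.lookup (mod2 f) k = of_int (Poly_Mapping.lookup f k)"
  unfolding mod2_def mpoly_eval_def monomial_eval_var
  by (auto simp: lookup_sum lookup_single when_def in_keys_iff mult_single simp flip: single_of_int)

lemma of_int_bit_eq_0_iff: "of_int n = (0 :: bit) \<longleftrightarrow> even n"
  by (cases "even n") (auto elim!: evenE oddE)

lemma mod2_eq_0_iff: "mod2 f = 0 \<longleftrightarrow> 2 dvd f"
proof
  assume "mod2 f = 0"
  then have "of_int (Poly_Mapping.lookup f k) = (0 :: bit)" for k
    using lookup_mod2[of f k] by simp
  then have even: "even (Poly_Mapping.lookup f k)" for k
    by (simp add: of_int_bit_eq_0_iff)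
  define h where "h = Poly_Mapping.map (\<lambda>c. c div 2) f"
  have "Poly_Mapping.lookup f k = Poly_Mapping.lookup h k + Poly_Mapping.lookup h k" for k
    using even[of k] by (auto simp: h_def map.rep_eq when_def elim!: evenE)
  then have "f = h + h" by (intro poly_mapping_eqI) (simp only: lookup_add)
  then show "2 dvd f" by (metis dvd_triv_left mult_2)
next
  assume "2 dvd f"
  then obtain h where "f = h + h" by (metis dvdE mult_2)
  then have "mod2 f = mod2 h + mod2 h" by (simp only: mod2.hom_add)
  moreover have "x + x = 0" for x :: bit by (cases x) simp_all
  ultimately show "mod2 f = 0"
    by (intro poly_mapping_eqI) (simp only: lookup_add lookup_zero)
qed

lemma two_mpoly_nonzero: "(2 :: 'i mpoly) \<noteq> 0"
  by (metis zero_neq_numeral)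

text \<open>\<open>mod2\<close> takes values in polynomials over the field \<open>bit\<close>, where
  a product is 0 only if a factor is.\<close>

lemma two_prime_mpoly: "2 dvd f * g \<Longrightarrow> 2 dvd f \<or> 2 dvd (g :: nat mpoly)"
  unfolding mod2_eq_0_iff[symmetric] by (simp add: mod2.hom_mult)

lemma power_two_dvd_mpoly:
  "2 ^ n dvd f * g \<Longrightarrow> \<not> 2 dvd g \<Longrightarrow> 2 ^ n dvd (f :: nat mpoly)"
proof (induction n arbitrary: f)
  case (Suc n)
  have "(2 :: nat mpoly) dvd 2 ^ Suc n" unfolding power_Suc by (rule dvd_triv_left)
  then have "2 dvd f * g" using Suc.prems(1) by (rule dvd_trans)
  then obtain f' where f: "f = 2 * f'" using two_prime_mpoly Suc.prems(2) by blast
  obtain h where "f * g = 2 ^ Suc n * h" using Suc.prems(1) by blast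
  then have "2 * (f' * g) = 2 * (2 ^ n * h)" unfolding f power_Suc by (simp only: mult.assoc)
  then have "f' * g = 2 ^ n * h" using two_mpoly_nonzero by (simp only: mult_cancel_left) blast
  then have "2 ^ n dvd f'" using Suc.IH Suc.prems(2) by simp
  then show ?case unfolding f power_Suc by (rule mult_dvd_mono[OF dvd_refl])
qed simp

lemma lookup_power_two_mult:
  "Poly_Mapping.lookup (2 ^ n * f) k = 2 ^ n * Poly_Mapping.lookup (f :: 'i mpoly) k"
proof (induction n arbitrary: k)
  case (Suc n)
  have "2 ^ Suc n * f = 2 ^ n * f + 2 ^ n * f"
    by (simp only: power_Suc mult_2 distrib_right)
  then show ?case using Suc by (simp only: lookup_add power_Suc mult_2 distrib_right)
qed simp

text \<open>The localization of \<open>\<int>[x\<^sub>0, x\<^sub>1, \<dots>]\<close> at the prime 2. The variables are indexed by \<open>nat\<close> because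
  the library needs linearly ordered exponents to provide a domain.\<close>

definition odd_denominators :: "nat mpoly fract set" where
  "odd_denominators = {Fract a b | a b. \<not> 2 dvd b}"

lemma odd_denominatorsI: "\<not> 2 dvd b \<Longrightarrow> Fract a b \<in> odd_denominators"
  unfolding odd_denominators_def by blast

lemma odd_denominatorsE:
  assumes "x \<in> odd_denominators" obtains a b where "x = Fract a b" "\<not> 2 dvd b"
  using assms unfolding odd_denominators_def by blast

abbreviation frac_of :: "nat mpoly \<Rightarrow> nat mpoly fract" where
  "frac_of x \<equiv> Fract x 1"

lemma not_two_dvd_one_mpoly: "\<not> 2 dvd (1 :: nat mpoly)"
  unfolding mod2_eq_0_iff[symmetric] by simp

lemma frac_of_inj: "frac_of x = frac_of y \<longleftrightarrow> x = y"
  by (simp add: eq_fract)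

interpretation frac_of: comm_ring_hom frac_of
  by unfold_locales (simp_all add: fract_collapse)

interpretation two_valuation odd_denominators
proof
  show "1 \<in> odd_denominators"
    unfolding odd_denominators_def One_fract_def using not_two_dvd_one_mpoly by blast
  show two: "(2 :: nat mpoly fract) \<noteq> 0"
    using frac_of_inj[of 2 0] by (simp add: frac_of.hom_numeral frac_of.hom_zero)
  fix x y :: "nat mpoly fract"
  have nz: "b \<noteq> 0" if "\<not> 2 dvd b" for b :: "nat mpoly" using that by auto
  show "- x \<in> odd_denominators" if x: "x \<in> odd_denominators"
    using x by (rule odd_denominatorsE) (simp add: odd_denominatorsI)
  show "x + y \<in> odd_denominators" "x * y \<in> odd_denominators"
    if "x \<in> odd_denominators" "y \<in> odd_denominators"
  proof -
    obtain a b a' b' where xy: "x = Fract a b" "y = Fract a' b'"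
      and odd: "\<not> 2 dvd b" "\<not> 2 dvd b'"
      using \<open>x \<in> _\<close> \<open>y \<in> _\<close> by (elim odd_denominatorsE)
    have odd': "\<not> 2 dvd b * b'" using odd two_prime_mpoly by blast
    show "x + y \<in> odd_denominators" "x * y \<in> odd_denominators"
      unfolding xy add_fract[OF nz[OF odd(1)] nz[OF odd(2)]] mult_fract
      by (rule odd_denominatorsI[OF odd'])+
  qed
  have half: "Fract a b / 2 = Fract a (2 * b)" for a b :: "nat mpoly"
  proof -
    have "(2 :: nat mpoly fract) = Fract 2 1" by (simp only: frac_of.hom_numeral)
    then show ?thesis by (simp only: divide_fract mult_1_right mult.commute[of b])
  qed
  show "1 / 2 \<notin> odd_denominators"
  proof
    assume "1 / 2 \<in> odd_denominators"
    then have "Fract 1 (2 * 1) \<in> odd_denominators" unfolding One_fract_def half .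
    then have "Fract 1 2 \<in> odd_denominators" unfolding mult_1_right .
    then obtain a b :: "nat mpoly" where "Fract 1 2 = Fract a b" "\<not> 2 dvd b"
      by (elim odd_denominatorsE)
    then have "b = 2 * a"
      using nz[of b] eq_fract(1)[of 2 b 1 a] two_mpoly_nonzero by (simp add: mult.commute)
    then show False using \<open>\<not> 2 dvd b\<close> by simp
  qed
  show "inverse x \<in> odd_denominators" if x_R: "x \<in> odd_denominators" and "x / 2 \<notin> odd_denominators"
  proof -
    obtain a b where x: "x = Fract a b" "\<not> 2 dvd b" using x_R by (rule odd_denominatorsE)
    have "\<not> 2 dvd a"
    proof
      assume "2 dvd a"
      then obtain a' where "a = 2 * a'" by blast
      then have "x / 2 = Fract a' b"
        unfolding x(1) half by (simp only: mult_fract_cancel[OF two_mpoly_nonzero])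
      then have "x / 2 \<in> odd_denominators" using odd_denominatorsI[OF x(2)] by (simp only:)
      then show False using \<open>x / 2 \<notin> odd_denominators\<close> by blast
    qed
    then show ?thesis using x odd_denominatorsI by simp
  qed
qed

lemma frac_of_R: "frac_of x \<in> odd_denominators"
  by (rule odd_denominatorsI[OF not_two_dvd_one_mpoly])

text \<open>As 2 is prime, an odd denominator cannot contribute a factor 2. Conditions on fractions
  thus become divisibility of polynomials, which is read off coefficients.\<close>

lemma frac_of_pow_ideal_iff: "frac_of x \<in> pow_ideal n \<longleftrightarrow> 2 ^ n dvd x"
proof
  have power_nz: "(2 :: nat mpoly) ^ n \<noteq> 0" using two_mpoly_nonzero by (rule power_not_zero)
  have div: "frac_of x / 2 ^ n = Fract x (2 ^ n)"
  proof -
    have "(2 :: nat mpoly fract) ^ n = frac_of (2 ^ n)"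
      by (simp only: frac_of.hom_power frac_of.hom_numeral)
    then show ?thesis by simp
  qed
  show "2 ^ n dvd x" if "frac_of x \<in> pow_ideal n"
  proof -
    have "Fract x (2 ^ n) \<in> odd_denominators" using that div by (simp add: pow_ideal_def)
    then obtain a b where ab: "Fract x (2 ^ n) = Fract a b" "\<not> 2 dvd b" by (elim odd_denominatorsE)
    then have "b \<noteq> 0" by auto
    then have "x * b = a * 2 ^ n" using ab(1) power_nz eq_fract(1) by blast
    then show ?thesis using power_two_dvd_mpoly[OF _ ab(2)] by (metis dvd_triv_right)
  qed
  show "frac_of x \<in> pow_ideal n" if "2 ^ n dvd x"
  proof -
    obtain y where "x = 2 ^ n * y" using \<open>2 ^ n dvd x\<close> by blast
    then have "Fract x (2 ^ n) = frac_of y" using power_nz eq_fract(1)[of "2 ^ n" 1 x y] by simp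
    then show ?thesis using div frac_of_R by (simp add: pow_ideal_def)
  qed
qed

section \<open>The lattice of vertex weights\<close>

inductive_set int_span :: "(int ^ 'm :: finite) set \<Rightarrow> (int ^ 'm) set" for W where
  int_span_zero: "0 \<in> int_span W"
| int_span_add_gen: "x \<in> int_span W \<Longrightarrow> w \<in> W \<Longrightarrow> x + w \<in> int_span W"
| int_span_diff_gen: "x \<in> int_span W \<Longrightarrow> w \<in> W \<Longrightarrow> x - w \<in> int_span W"

lemma int_span_add:
  assumes "x \<in> int_span W" "y \<in> int_span W" shows "x + y \<in> int_span W"
  using assms(2,1)
proof (induction y rule: int_span.induct)
  case (int_span_add_gen y w)
  then show ?case using int_span.int_span_add_gen[of "x + y" W w] by (simp add: add.assoc)
next
  case (int_span_diff_gen y w)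
  then show ?case using int_span.int_span_diff_gen[of "x + y" W w] by (simp add: add_diff_eq)
qed simp

lemma int_span_gen: "w \<in> W \<Longrightarrow> w \<in> int_span W"
  using int_span_add_gen[OF int_span_zero, of w W] by simp

lemma int_span_uminus: "x \<in> int_span W \<Longrightarrow> - x \<in> int_span W"
proof (induction x rule: int_span.induct)
  case (int_span_add_gen y w)
  moreover have "- (y + w) = - y - w" by simp
  ultimately show ?case using int_span.int_span_diff_gen[of "- y" W w] by metis
next
  case (int_span_diff_gen y w)
  moreover have "- (y - w) = - y + w" by simp
  ultimately show ?case using int_span.int_span_add_gen[of "- y" W w] by metis
qed (simp add: int_span_zero)

lemma int_span_diff: "x \<in> int_span W \<Longrightarrow> y \<in> int_span W \<Longrightarrow> x - y \<in> int_span W"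
  using int_span_add[of x W "- y"] int_span_uminus[of y W] by simp

lemma int_span_scale: "x \<in> int_span W \<Longrightarrow> c *s x \<in> int_span W"
proof (induction c rule: int_induct[where k = 0])
  case (step1 i)
  then show ?case using int_span_add[of "i *s x" W x] by (simp add: vector_sadd_rdistrib)
next
  case (step2 i)
  then show ?case using int_span_diff[of "i *s x" W x] by (simp add: vector_ssub_ldistrib vector_sub_rdistrib)
qed (simp add: int_span_zero)

lemma int_span_sum: "(\<And>i. i \<in> S \<Longrightarrow> f i \<in> int_span W) \<Longrightarrow> sum f S \<in> int_span W"
  by (induction S rule: infinite_finite_induct) (simp_all add: int_span_zero int_span_add)

lemma int_span_subset:
  assumes "W' \<subseteq> int_span W" shows "int_span W' \<subseteq> int_span W"
proof
  fix x assume "x \<in> int_span W'" then show "x \<in> int_span W"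
    by (induction x rule: int_span.induct)
      (use assms in \<open>auto intro: int_span_zero int_span_add int_span_diff\<close>)
qed

lemma int_span_nonzero_component: "x \<in> int_span W \<Longrightarrow> x $ i \<noteq> 0 \<Longrightarrow> \<exists>w\<in>W. w $ i \<noteq> 0"
proof (rule ccontr)
  assume "x \<in> int_span W" "x $ i \<noteq> 0" and *: "\<not> (\<exists>w\<in>W. w $ i \<noteq> 0)"
  have "x $ i = 0" using \<open>x \<in> int_span W\<close> by (induction x rule: int_span.induct) (use * in auto)
  then show False using \<open>x $ i \<noteq> 0\<close> by simp
qed

definition norm1 :: "int ^ 'm :: finite \<Rightarrow> int" where
  "norm1 w = (\<Sum>i\<in>UNIV. \<bar>w $ i\<bar>)"

text \<open>Gaussian elimination with pivots \<open>\<plusminus>1\<close> does not increase the \<open>\<ell>\<^sup>1\<close>-norm of vectors of norm at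
  most 2; once there is no pivot left, all vectors are of the form \<open>\<plusminus>2e\<^sub>i\<close> or 0.\<close>

lemma int_span_index_two:
  fixes z :: "int ^ 'm :: finite"
  assumes "finite W" "\<And>w. w \<in> W \<Longrightarrow> norm1 w \<le> 2" "c *s z \<in> int_span W" "c \<noteq> 0"
  shows "2 *s z \<in> int_span W"
  using assms
proof (induction "card (W - {0})" arbitrary: W z rule: less_induct)
  case less
  show ?case
  proof (cases "\<exists>b\<in>W. \<exists>i. \<bar>b $ i\<bar> = 1")
    case True
    then obtain b i where b: "b \<in> W" "\<bar>b $ i\<bar> = 1" by blast
    \<comment> \<open>Clears coordinate \<open>i\<close> by means of \<open>b\<close>. Since
      \<open>b $ i\<close> is 1 or -1 it is its own inverse and the multiple is integral. The vector
      \<open>b\<close> itself goes to 0, so fewer nonzero vectors remain.\<close>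
    define \<phi> where "\<phi> x = x - (x $ i * b $ i) *s b" for x
    have bb: "b $ i * b $ i = 1" using b(2) by (metis abs_mult_self_eq mult_1)
    have \<phi>_b: "\<phi> b = 0" by (simp add: \<phi>_def bb)
    have \<phi>_add: "\<phi> (x + y) = \<phi> x + \<phi> y" and \<phi>_diff: "\<phi> (x - y) = \<phi> x - \<phi> y" for x y
      by (simp_all add: \<phi>_def Finite_Cartesian_Product.vec_eq_iff algebra_simps)
    have \<phi>_scale: "\<phi> (k *s x) = k *s \<phi> x" for k x
      by (simp add: \<phi>_def Finite_Cartesian_Product.vec_eq_iff algebra_simps)
    have \<phi>_span: "\<phi> x \<in> int_span (\<phi> ` W)" if "x \<in> int_span W" for x
      using that
      by (induction x rule: int_span.induct)
        (auto simp: \<phi>_add \<phi>_diff intro: int_span.intros, simp add: \<phi>_def int_span_zero)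
    have "\<phi> ` W \<subseteq> int_span W"
      unfolding \<phi>_def using b(1)
      by (intro image_subsetI int_span_diff int_span_scale int_span_gen)
    then have sub: "int_span (\<phi> ` W) \<subseteq> int_span W" by (rule int_span_subset)
    have norm_\<phi>: "norm1 (\<phi> w) \<le> 2" if "w \<in> W" for w
    proof -
      have split: "norm1 x = \<bar>x $ i\<bar> + (\<Sum>j\<in>UNIV - {i}. \<bar>x $ j\<bar>)" for x :: "int ^ 'm"
        unfolding norm1_def by (rule sum.remove) auto
      have "\<phi> w $ i = 0" using bb by (simp add: \<phi>_def mult.assoc)
      moreover have "(\<Sum>j\<in>UNIV - {i}. \<bar>\<phi> w $ j\<bar>)
          \<le> (\<Sum>j\<in>UNIV - {i}. \<bar>w $ j\<bar> + \<bar>w $ i\<bar> * \<bar>b $ j\<bar>)"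
      proof (rule sum_mono)
        fix j
        have "\<bar>\<phi> w $ j\<bar> \<le> \<bar>w $ j\<bar> + \<bar>w $ i * b $ i * b $ j\<bar>"
          unfolding \<phi>_def by (simp add: abs_triangle_ineq4)
        then show "\<bar>\<phi> w $ j\<bar> \<le> \<bar>w $ j\<bar> + \<bar>w $ i\<bar> * \<bar>b $ j\<bar>"
          using b(2) by (simp add: abs_mult)
      qed
      ultimately have "norm1 (\<phi> w)
          \<le> (\<Sum>j\<in>UNIV - {i}. \<bar>w $ j\<bar>) + \<bar>w $ i\<bar> * (\<Sum>j\<in>UNIV - {i}. \<bar>b $ j\<bar>)"
        by (simp add: split[of "\<phi> w"] sum.distrib sum_distrib_left)
      \<comment> \<open>This is the norm bound 2 minus the pivot. The elimination thus adds at most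
        \<open>\<bar>w $ i\<bar>\<close> in the other coordinates, which is what it removes in
        coordinate \<open>i\<close>.\<close>
      also have "(\<Sum>j\<in>UNIV - {i}. \<bar>b $ j\<bar>) \<le> 1"
        using less.prems(2)[OF b(1)] b(2) split[of b] by simp
      then have "\<bar>w $ i\<bar> * (\<Sum>j\<in>UNIV - {i}. \<bar>b $ j\<bar>) \<le> \<bar>w $ i\<bar> * 1"
        by (rule mult_left_mono) simp
      finally show ?thesis using less.prems(2)[OF that] split[of w] by simp
    qed
    have "\<phi> ` W - {0} \<subseteq> \<phi> ` (W - {0} - {b})" using \<phi>_b by (auto simp: \<phi>_def)
    then have "card (\<phi> ` W - {0}) \<le> card (W - {0} - {b})"
      using less.prems(1) by (meson card_image_le card_mono finite_Diff finite_imageI le_trans)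
    also have "\<dots> < card (W - {0})"
      using b less.prems(1) by (intro card_Diff1_less) auto
    finally have "2 *s \<phi> z \<in> int_span (\<phi> ` W)"
      using less.hyps[of "\<phi> ` W" "\<phi> z"] less.prems norm_\<phi> \<phi>_span[OF less.prems(3)]
      by (auto simp: \<phi>_scale)
    then have "2 *s \<phi> z \<in> int_span W" using sub by blast
    from int_span_add[OF this int_span_scale[OF int_span_gen[OF b(1)]]]
    have "2 *s \<phi> z + (2 * (z $ i * b $ i)) *s b \<in> int_span W" .
    also have "2 *s \<phi> z + (2 * (z $ i * b $ i)) *s b = 2 *s z"
      by (simp add: \<phi>_def Finite_Cartesian_Product.vec_eq_iff algebra_simps)
    finally show ?thesis .
  next
    case False
    have axis: "2 *s e i \<in> int_span W" if nz: "z $ i \<noteq> 0" for i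
    proof -
      obtain w where w: "w \<in> W" "w $ i \<noteq> 0"
        using int_span_nonzero_component[OF less.prems(3), of i] nz less.prems(4)
        by (metis mult_eq_0_iff vector_smult_component)
      have "\<bar>w $ i\<bar> \<noteq> 1" using False w(1) by blast
      then have ge: "\<bar>w $ i\<bar> \<ge> 2" using w(2) by linarith
      have split: "norm1 w = \<bar>w $ i\<bar> + (\<Sum>j\<in>UNIV - {i}. \<bar>w $ j\<bar>)"
        unfolding norm1_def by (rule sum.remove) auto
      have nonneg: "(\<Sum>j\<in>UNIV - {i}. \<bar>w $ j\<bar>) \<ge> 0" by (rule sum_nonneg) simp
      then have "(\<Sum>j\<in>UNIV - {i}. \<bar>w $ j\<bar>) = 0" and two: "\<bar>w $ i\<bar> = 2"
        using ge split less.prems(2)[OF w(1)] by linarith+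
      then have other: "w $ j = 0" if "j \<noteq> i" for j
        using that by (simp add: sum_nonneg_eq_0_iff)
      have "2 *s e i = sgn (w $ i) *s w"
        using other two by (auto simp: Finite_Cartesian_Product.vec_eq_iff axis_nth sgn_if)
      then show ?thesis using int_span_scale[OF int_span_gen[OF w(1)]] by metis
    qed
    have "2 *s z = (\<Sum>i\<in>UNIV. z $ i *s (2 *s e i))"
      by (simp add: Finite_Cartesian_Product.vec_eq_iff axis_nth if_distrib cong: if_cong)
    moreover have "z $ i *s (2 *s e i) \<in> int_span W" for i
    proof (cases "z $ i = 0")
      case False then show ?thesis by (intro int_span_scale axis)
    qed (simp add: int_span_zero)
    ultimately show ?thesis by (simp only: int_span_sum)
  qed
qed

text \<open>The diagonal entry at \<open>u\<close> is the linear form of \<open>weight u\<close>.\<close>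

fun weight :: "'m :: finite elt \<Rightarrow> int ^ 'm" where
  "weight (Black a) = - a"
| "weight (Red a) = a"

section \<open>Affine independence of the weights\<close>

fun is_red :: "'m :: finite elt \<Rightarrow> bool" where
  "is_red (Black a) \<longleftrightarrow> False"
| "is_red (Red a) \<longleftrightarrow> True"

lemma elt_eqI: "is_red u = is_red v \<Longrightarrow> weight u = weight v \<Longrightarrow> u = v"
  by (cases u; cases v) auto

text \<open>Up to a sign given by the colour of \<open>h\<close>, the vectors in
  \<open>nondegenerate\<close> are differences of weights. Passing to weights removes the group law
  from the argument.\<close>

lemma lattice_part_quotient:
  "lattice_part (h \<otimes>\<^sub>G ginv g) = (if is_red h then weight h - weight g else weight g - weight h)"
  by (cases h; cases g) auto

lemma sum_indicator_scale:
  fixes f :: "'a \<Rightarrow> int ^ 'm :: finite"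
  assumes "finite A" "u \<in> A"
  shows "(\<Sum>w\<in>A. (if w = u then 1 else 0) *s f w) = f u"
proof -
  have "(if w = u then 1 else 0) *s f w = (if w = u then f w else 0)" for w by simp
  then show ?thesis using assms by simp
qed

text \<open>As the coefficients add up to 0, the relation becomes one among the
  \<open>weight h - weight g\<close> with \<open>g\<close> the base point of
  \<open>nondegenerate\<close>; up to sign these are the independent vectors given there. The
  coefficient of \<open>g\<close> then follows from \<open>sum0\<close>.\<close>

lemma affine_independent:
  assumes "is_graph A" "nondegenerate A"
    and sum0: "(\<Sum>v\<in>A. n v) = 0" and rel: "(\<Sum>v\<in>A. n v *s weight v) = 0" and v: "v \<in> A"
  shows "n v = (0 :: int)"
proof -
  have fin: "finite A" using assms(1) by (simp add: is_graph_def)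
  obtain g where g: "g \<in> A" and
    inj: "inj_on lattice_part ((\<lambda>h. h \<otimes>\<^sub>G ginv g) ` A - {gone})" and
    indep: "independent ((\<lambda>h. (\<chi> i. real_of_int (lattice_part h $ i)) :: real ^ 'a) `
        ((\<lambda>h. h \<otimes>\<^sub>G ginv g) ` A - {gone}))"
    using assms(2) by (auto simp: nondegenerate_def Let_def)
  define q where "q h = h \<otimes>\<^sub>G ginv g" for h
  define r where "r h = (\<chi> i. real_of_int (lattice_part h $ i))" for h :: "'a elt"
  have q_inj: "q h = q h' \<longleftrightarrow> h = h'" for h h'
    by (cases h; cases h'; cases g) (auto simp: q_def)
  have q_one: "q h = gone \<longleftrightarrow> h = g" for h
    by (cases h; cases g) (auto simp: q_def)
  have image: "q ` A - {gone} = q ` (A - {g})" using q_one by auto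
  have inj_rq: "inj_on (r \<circ> q) (A - {g})"
  proof (rule inj_onI)
    fix h h' assume h: "h \<in> A - {g}" "h' \<in> A - {g}" "(r \<circ> q) h = (r \<circ> q) h'"
    then have "lattice_part (q h) = lattice_part (q h')"
      by (auto simp: r_def Finite_Cartesian_Product.vec_eq_iff fun_eq_iff)
    then have "q h = q h'"
      using inj h(1,2) image by (auto simp: q_def[abs_def] dest!: inj_onD)
    then show "h = h'" by (simp add: q_inj)
  qed
  define s where "s h = (if is_red h then 1 else -1 :: int)" for h :: "'a elt"
  have s_s: "s h * s h = 1" for h by (simp add: s_def)
  have weight_diff: "weight h - weight g = s h *s lattice_part (q h)" for h
    by (simp add: q_def lattice_part_quotient s_def Finite_Cartesian_Product.vec_eq_iff)
  have "(\<Sum>h\<in>A. n h *s (weight h - weight g)) = 0"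
    using rel sum0 by (simp add: Finite_Cartesian_Product.vec_eq_iff algebra_simps sum_subtractf flip: sum_distrib_left sum_distrib_right)
  then have "(\<Sum>h\<in>A - {g}. n h *s (weight h - weight g)) = 0"
    using g fin by (simp add: sum.remove[of A g])
  then have rel': "(\<Sum>h\<in>A - {g}. (n h * s h) *s lattice_part (q h)) = 0"
    by (simp add: weight_diff)
  have "(\<Sum>h\<in>A - {g}. real_of_int (n h * s h) *\<^sub>R (r \<circ> q) h) = 0"
  proof -
    have "(\<Sum>h\<in>A - {g}. n h * s h * lattice_part (q h) $ i) = 0" for i
      using arg_cong[OF rel', of "\<lambda>x. x $ i"] by simp
    then have "(\<Sum>h\<in>A - {g}. real_of_int (n h * s h * lattice_part (q h) $ i)) = 0" for i
      by (metis of_int_0 of_int_sum)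
    then show ?thesis by (simp add: Finite_Cartesian_Product.vec_eq_iff r_def)
  qed
  moreover have "independent ((r \<circ> q) ` (A - {g}))"
    using indep image by (simp add: q_def[abs_def] r_def[abs_def] image_comp)
  ultimately have rns: "real_of_int (n h * s h) = 0" if "h \<in> A - {g}" for h
  proof -
    let ?B = "(r \<circ> q) ` (A - {g})"
    \<comment> \<open>Independence speaks of a set of vectors, so the coefficients are carried along
      the injection \<open>r \<circ> q\<close>.\<close>
    define u where "u b = real_of_int (n (inv_into (A - {g}) (r \<circ> q) b) * s (inv_into (A - {g}) (r \<circ> q) b))" for b
    have "(\<Sum>b\<in>?B. u b *\<^sub>R b) = (\<Sum>h\<in>A - {g}. real_of_int (n h * s h) *\<^sub>R (r \<circ> q) h)"
      by (subst sum.reindex[OF inj_rq]) (auto simp: u_def inv_into_f_f[OF inj_rq, simplified] intro!: sum.cong)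
    then have "(\<Sum>b\<in>?B. u b *\<^sub>R b) = 0"
      using \<open>(\<Sum>h\<in>A - {g}. real_of_int (n h * s h) *\<^sub>R (r \<circ> q) h) = 0\<close> by simp
    then have "u ((r \<circ> q) h) = 0"
      using \<open>independent ?B\<close> that fin independentD[of ?B ?B u "(r \<circ> q) h"] by auto
    then show ?thesis using that inv_into_f_f[OF inj_rq that] by (simp add: u_def)
  qed
  then have others: "n h = 0" if "h \<in> A - {g}" for h
  proof -
    have "s h \<noteq> 0" by (simp add: s_def)
    moreover have "n h * s h = 0" using rns[OF that] by (simp only: of_int_eq_0_iff)
    ultimately show ?thesis by simp
  qed
  then have "n g = 0" using sum0 g fin by (simp add: sum.remove[of A g])
  then show ?thesis using others v by (cases "v = g") auto
qed

text \<open>Equal differences are an affine relation among at most four weights, so all its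
  coefficients vanish. Hence no two directed edges have the same vector and, with
  \<open>u' = v'\<close>, distinct vertices have distinct weights.\<close>

lemma weight_diff_unique:
  assumes "is_graph A" "nondegenerate A" and mem: "u \<in> A" "v \<in> A" "u' \<in> A" "v' \<in> A"
    and "u \<noteq> v" and eq: "weight u - weight v = weight u' - weight v'"
  shows "u = u' \<and> v = v'"
proof -
  define n where "n w = (if w = u then 1 else 0) - (if w = v then 1 else 0)
    - (if w = u' then 1 else 0) + (if w = v' then 1 else 0 :: int)" for w
  have fin: "finite A" using assms(1) by (simp add: is_graph_def)
  have "(\<Sum>w\<in>A. n w) = 0"
    using mem fin by (simp add: n_def sum.distrib sum_subtractf)
  moreover have "(\<Sum>w\<in>A. n w *s weight w) = 0"
    unfolding n_def vector_sadd_rdistrib vector_sub_rdistrib sum.distrib sum_subtractf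
      mem[THEN sum_indicator_scale[OF fin]] using eq by simp
  ultimately have "n w = 0" if "w \<in> A" for w
    using affine_independent[OF assms(1,2)] that by blast
  from this[OF mem(1)] this[OF mem(2)] show ?thesis using \<open>u \<noteq> v\<close>
    by (auto simp: n_def split: if_splits)
qed

lemma marked_edge_cases:
  assumes "marked_edge x u v"
  obtains i j where "i \<noteq> j" "sqrt_mark x = var i * var j" "is_red v = is_red u"
      "weight v - weight u = e i - e j"
    | i j where "i \<noteq> j" "sqrt_mark x = var i * var j" "is_red v \<noteq> is_red u"
      "weight v - weight u = (if is_red v then - (e i + e j) else e i + e j)"
proof -
  have v: "v = x \<otimes>\<^sub>G u" and x: "x \<in> gens" using assms by (auto simp: marked_edge_def)
  from x consider i j where "x = Black (e i - e j)" "i \<noteq> j" | i j where "x = Red (- e i - e j)" "i \<noteq> j"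
    by (auto simp: gens_def)
  then show thesis
  proof cases
    case 1
    show thesis
    proof (cases u)
      case (Black a)
      \<comment> \<open>The weight of a black vertex is minus its lattice part, so the two indices
        change places.\<close>
      then show thesis using 1 v that(1)[of j i] sqrt_mark_Black[of i j] by (simp add: mult.commute)
    next
      case (Red a)
      then show thesis using 1 v that(1)[of i j] sqrt_mark_Black[of i j] by simp
    qed
  next
    case 2
    show thesis
      by (cases u) (use 2 v that(2)[of i j] sqrt_mark_Red[of i j] in \<open>simp_all add: algebra_simps\<close>)
  qed
qed

lemma norm1_edge:
  assumes "marked_edge x u v" shows "norm1 (weight v - weight u) \<le> 2"
proof -
  have "norm1 (e i - e j) \<le> 2" "norm1 (- (e i + e j)) \<le> 2" "norm1 (e i + e j) \<le> 2" for i j :: 'a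
  proof -
    have "(\<Sum>k\<in>UNIV. \<bar>(e i - e j) $ k\<bar>) \<le> (\<Sum>k\<in>UNIV. \<bar>e i $ k\<bar> + \<bar>e j $ k\<bar>)"
      "(\<Sum>k\<in>UNIV. \<bar>(e i + e j) $ k\<bar>) \<le> (\<Sum>k\<in>UNIV. \<bar>e i $ k\<bar> + \<bar>e j $ k\<bar>)"
      by (rule sum_mono; simp add: abs_triangle_ineq abs_triangle_ineq4)+
    moreover have "(\<Sum>k\<in>UNIV. \<bar>e i $ k\<bar> + \<bar>e j $ k\<bar>) = 2"
    proof -
      have "(\<Sum>k\<in>UNIV. \<bar>e l $ k\<bar>) = 1" for l :: 'a
        by (simp add: axis_nth if_distrib cong: if_cong)
      then show ?thesis by (simp only: sum.distrib)
    qed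
    moreover have "norm1 (- (e i + e j)) = norm1 (e i + e j)"
      unfolding norm1_def by (simp only: vector_uminus_component abs_minus_cancel)
    ultimately show "norm1 (e i - e j) \<le> 2" "norm1 (- (e i + e j)) \<le> 2" "norm1 (e i + e j) \<le> 2"
      by (simp_all add: norm1_def)
  qed
  then show ?thesis using assms by (elim marked_edge_cases) (auto split: if_splits)
qed

text \<open>If \<open>weight u - weight v = 4z\<close>, then \<open>2z\<close> is an integral combination of the edge vectors, hence of
  differences of weights, although \<open>2z\<close> is half of such a difference: this contradicts affine
  independence.\<close>

lemma weight_diff_not_four_dvd:
  assumes "is_graph A" "connected_graph A" "nondegenerate A"
    and mem: "u \<in> A" "v \<in> A" and "u \<noteq> v"
  shows "\<exists>i. \<not> 4 dvd (weight u - weight v) $ i"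
proof (rule ccontr)
  assume "\<not> ?thesis"
  then have dvd: "4 dvd (weight u - weight v) $ i" for i by blast
  define z where "z = (\<chi> i. (weight u - weight v) $ i div 4)"
  have z: "4 *s z = weight u - weight v"
  proof (rule iffD2[OF Finite_Cartesian_Product.vec_eq_iff], intro allI)
    show "(4 *s z) $ i = (weight u - weight v) $ i" for i using dvd[of i] by (simp add: z_def)
  qed
  have fin: "finite A" using assms(1) by (simp add: is_graph_def)
  define W where "W = {weight q - weight p | p q. p \<in> A \<and> q \<in> A \<and> (\<exists>x. marked_edge x p q)}"
  have "W \<subseteq> (\<lambda>(p, q). weight q - weight p) ` (A \<times> A)" by (auto simp: W_def)
  then have "finite W" using fin finite_subset by blast
  moreover have "norm1 w \<le> 2" if "w \<in> W" for w using that norm1_edge by (auto simp: W_def)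
  moreover have "weight u - weight v \<in> int_span W"
  proof -
    have "(v, u) \<in> {(p, q). p \<in> A \<and> q \<in> A \<and> (\<exists>x. marked_edge x p q)}\<^sup>*"
      using assms(2) mem by (simp add: connected_graph_def)
    then show ?thesis
    proof (induction rule: rtrancl_induct)
      case (step p q)
      then have "weight q - weight p \<in> W" by (auto simp: W_def)
      from int_span_add_gen[OF step.IH this] show ?case by simp
    qed (simp add: int_span_zero)
  qed
  ultimately have "2 *s z \<in> int_span W"
    using int_span_index_two[of W 4 z] z by simp
  moreover have "\<exists>n. (\<Sum>w\<in>A. n w) = 0 \<and> (\<Sum>w\<in>A. n w *s weight w) = y" if "y \<in> int_span W" for y
    using that
  proof (induction y rule: int_span.induct)
    case int_span_zero
    show ?case by (rule exI[of _ "\<lambda>_. 0"]) simp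
  next
    case (int_span_add_gen y w)
    then obtain n p q where n: "(\<Sum>w\<in>A. n w) = 0" "(\<Sum>w\<in>A. n w *s weight w) = y"
      and pq: "p \<in> A" "q \<in> A" "w = weight q - weight p" by (auto simp: W_def)
    show ?case
      by (rule exI[of _ "\<lambda>w. n w + (if w = q then 1 else 0) - (if w = p then 1 else 0)"])
        (use n pq fin in \<open>simp add: vector_sadd_rdistrib vector_sub_rdistrib sum.distrib
            sum_subtractf sum_indicator_scale\<close>)
  next
    case (int_span_diff_gen y w)
    then obtain n p q where n: "(\<Sum>w\<in>A. n w) = 0" "(\<Sum>w\<in>A. n w *s weight w) = y"
      and pq: "p \<in> A" "q \<in> A" "w = weight q - weight p" by (auto simp: W_def)
    show ?case
      by (rule exI[of _ "\<lambda>w. n w - (if w = q then 1 else 0) + (if w = p then 1 else 0)"])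
        (use n pq fin in \<open>simp add: vector_sadd_rdistrib vector_sub_rdistrib sum.distrib
            sum_subtractf sum_indicator_scale\<close>)
  qed
  ultimately obtain n where n: "(\<Sum>w\<in>A. n w) = 0" "(\<Sum>w\<in>A. n w *s weight w) = 2 *s z" by blast
  \<comment> \<open>Twice the combination for \<open>2z\<close> minus the one for
    \<open>4z = weight u - weight v\<close>. The coefficient at \<open>u\<close> is
    \<open>2 * n u - 1\<close>, which is odd.\<close>
  define n' where "n' w = 2 * n w - (if w = u then 1 else 0) + (if w = v then 1 else 0)" for w
  have "(\<Sum>w\<in>A. n' w) = 0"
    using n(1) mem fin by (simp add: n'_def sum.distrib sum_subtractf flip: sum_distrib_left)
  moreover have "(\<Sum>w\<in>A. n' w *s weight w) = 0"
  proof -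
    have "(\<Sum>w\<in>A. n' w *s weight w) = 2 *s (\<Sum>w\<in>A. n w *s weight w) - weight u + weight v"
      unfolding n'_def vector_sadd_rdistrib vector_sub_rdistrib sum.distrib sum_subtractf
        sum_indicator_scale[OF fin mem(1)] sum_indicator_scale[OF fin mem(2)]
      by (simp add: Finite_Cartesian_Product.vec_eq_iff sum_distrib_left mult.assoc)
    then show ?thesis using n(2) z by (simp add: Finite_Cartesian_Product.vec_eq_iff algebra_simps)
  qed
  ultimately have "n' u = 0" using affine_independent[OF assms(1,3)] mem(1) by blast
  then have "2 * n u = 1" using \<open>u \<noteq> v\<close> by (simp add: n'_def)
  then have "even (1 :: int)" by (metis dvd_triv_left)
  then show False by simp
qed

section \<open>Edges and matrix entries\<close>

abbreviation edge :: "'m :: finite elt \<Rightarrow> 'm elt \<Rightarrow> bool" where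
  "edge u v \<equiv> \<exists>x. marked_edge x u v"

definition edge_mark :: "'m :: finite elt \<Rightarrow> 'm elt \<Rightarrow> 'm mpoly" where
  "edge_mark u v = (if edge u v then sqrt_mark (v \<otimes>\<^sub>G ginv u) else 0)"

definition color_sign :: "'m :: finite elt \<Rightarrow> 'a :: ring_1" where
  "color_sign v = (if is_red v then - 1 else 1)"

lemma edge_mark_marked: "marked_edge x u v \<Longrightarrow> edge_mark u v = sqrt_mark x"
  using marked_edge_mark by (auto simp: edge_mark_def)

lemma edge_cases:
  assumes "edge u v"
  obtains i j where "i \<noteq> j" "edge_mark u v = var i * var j" "is_red v = is_red u"
      "weight v - weight u = e i - e j"
    | i j where "i \<noteq> j" "edge_mark u v = var i * var j" "is_red v \<noteq> is_red u"
      "weight v - weight u = (if is_red v then - (e i + e j) else e i + e j)"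
proof -
  from assms obtain x where x: "marked_edge x u v" by blast
  show thesis
    using x by (rule marked_edge_cases) (use that edge_mark_marked[OF x] in metis)+
qed

lemma edge_mark_sym: "edge_mark u v = edge_mark v u"
proof -
  have *: "\<exists>y. marked_edge y v u \<and> sqrt_mark y = sqrt_mark x" if x: "marked_edge x u v"
    for x and u v :: "'a elt"
  proof -
    from x consider i j where "x = Black (e i - e j)" "i \<noteq> j" | i j where "x = Red (- e i - e j)" "i \<noteq> j"
      by (auto simp: marked_edge_def gens_def)
    then show ?thesis
    proof cases
      case 1
      then have "marked_edge (Black (e j - e i)) v u"
        using x by (cases u) (auto simp: marked_edge_def gens_def)
      moreover have "sqrt_mark (Black (e j - e i)) = sqrt_mark x"
        using 1 by (simp add: sqrt_mark_Black mult.commute)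
      ultimately show ?thesis by blast
    next
      case 2
      then have "marked_edge x v u"
        using x by (cases u) (auto simp: marked_edge_def gens_def)
      then show ?thesis by blast
    qed
  qed
  show ?thesis
  proof (cases "edge u v")
    case True
    then show ?thesis using * edge_mark_marked by metis
  next
    case False
    then have "\<not> edge v u" using * by blast
    then show ?thesis using False by (simp add: edge_mark_def)
  qed
qed

text \<open>Both kinds of edge vector agree modulo 2 with \<open>e i + e j\<close>, so parity alone
  recovers the indices of the mark.\<close>

lemma edge_parity:
  assumes "edge u v"
  obtains i j where "i \<noteq> j" "edge_mark u v = var i * var j"
    "\<And>n. odd ((weight v - weight u) $ n) \<longleftrightarrow> n \<in> {i, j}"
  using assms
proof (cases rule: edge_cases)
  case (1 i j)
  show thesis by (rule that[of i j]) (use 1 in \<open>auto simp: axis_nth\<close>)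
next
  case (2 i j)
  show thesis by (rule that[of i j]) (use 2 in \<open>auto simp: axis_nth\<close>)
qed

lemma edge_neq: "edge u v \<Longrightarrow> u \<noteq> v"
proof
  assume "edge u v" "u = v"
  then show False by (elim edge_parity) force
qed

text \<open>The sign of an off-diagonal entry depends only on the colour of its column. Off the
  diagonal the matrix is therefore symmetric up to a diagonal factor of signs, whence a closed walk
  and its reverse have the same product.\<close>

lemma entry_eq:
  "entry u v = (if u = v then xi_form (weight u) else 2 * (color_sign v * edge_mark u v))"
proof (cases "u = v")
  case True
  then show ?thesis
    by (cases v) (simp_all add: entry_def xi_form_def flip: sum_negf)
next
  case False
  show ?thesis
    using False by (cases u; cases v) (auto simp: entry_def edge_mark_def color_sign_def)
qed

text \<open>For black \<open>a\<close> and red \<open>b\<close> the forbidden sum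
  \<open>a + b\<close> is the difference of the weights.\<close>

lemma allowable_weight:
  assumes "allowable A" "u \<in> A" "v \<in> A" "\<not> is_red u" "is_red v"
  shows "weight v - weight u \<noteq> - 2 *s e i"
proof
  assume *: "weight v - weight u = - 2 *s e i"
  obtain a where u: "u = Black a" using assms(4) by (cases u) auto
  obtain b where v: "v = Red b" using assms(5) by (cases v) auto
  have "a + b = - 2 *s e i" using * by (simp add: u v add.commute)
  then show False using assms(1,2,3) u v by (auto simp: allowable_def)
qed

text \<open>If \<open>weight u\<close> and \<open>weight w\<close> were congruent modulo 2, both edges would carry the same pair of
  indices: two marks of the same colour contradict non-degeneracy, two marks of different colours
  produce a forbidden pair of vertices.\<close>

lemma two_path_parity:
  assumes A: "is_graph A" "nondegenerate A" "allowable A"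
    and mem: "u \<in> A" "v \<in> A" "w \<in> A" and edges: "edge u v" "edge v w" and neq: "u \<noteq> w"
  shows "\<exists>n. odd ((weight u - weight w) $ n)"
proof (rule ccontr)
  assume "\<not> ?thesis"
  then have "even ((weight v - weight u) $ n + (weight w - weight v) $ n)" for n
    by (simp add: algebra_simps)
  then have parity: "odd ((weight v - weight u) $ n) \<longleftrightarrow> odd ((weight w - weight v) $ n)" for n
    by (metis even_add)
  have uv: "u \<noteq> v" using edge_neq[OF edges(1)] .
  \<comment> \<open>Equal consecutive steps would repeat a weight difference of distinct
    vertices.\<close>
  have unique: "weight v - weight u \<noteq> weight w - weight v"
    using weight_diff_unique[OF A(1,2) mem(2,1,3,2)] uv by blast
  have return: "weight w \<noteq> weight u" if "is_red w = is_red u"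
    using elt_eqI that neq by metis
  have sets: "{i, j} = {k, l}"
    if "\<And>n. odd ((weight v - weight u) $ n) \<longleftrightarrow> n \<in> {i, j}"
      "\<And>n. odd ((weight w - weight v) $ n) \<longleftrightarrow> n \<in> {k, l}" for i j k l
    using that parity by blast
  have sum: "weight w - weight u = (weight w - weight v) + (weight v - weight u)" by simp
  have mixed: "\<not> (\<exists>i. weight w - weight u = (if is_red w then - 2 *s e i else 2 *s e i))"
    if "is_red w \<noteq> is_red u"
  proof
    assume "\<exists>i. weight w - weight u = (if is_red w then - 2 *s e i else 2 *s e i)"
    then obtain i where i: "weight w - weight u = (if is_red w then - 2 *s e i else 2 *s e i)"
      by blast
    show False
    proof (cases "is_red w")
      case True
      then show ?thesis using allowable_weight[OF A(3) mem(1,3)] that i by auto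
    next
      case False
      then have "weight u - weight w = - 2 *s e i"
        using i by (simp add: Finite_Cartesian_Product.vec_eq_iff algebra_simps)
      then show ?thesis using allowable_weight[OF A(3) mem(3,1)] that False by auto
    qed
  qed
  have pair: "(i = k \<and> j = l) \<or> (i = l \<and> j = k)" if "{i, j} = {k, l}" for i j k l :: 'a
    using that by (auto simp: doubleton_eq_iff)
  show False
    using edges(1)
  proof (cases rule: edge_cases)
    case uv: (1 i j)
    then have p1: "odd ((weight v - weight u) $ n) \<longleftrightarrow> n \<in> {i, j}" for n by (auto simp: axis_nth)
    show False using edges(2)
    proof (cases rule: edge_cases)
      case vw: (1 k l)
      then have "odd ((weight w - weight v) $ n) \<longleftrightarrow> n \<in> {k, l}" for n by (auto simp: axis_nth)
      from pair[OF sets[OF p1 this]] show False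
      proof
        assume "i = k \<and> j = l"
        then show False using unique uv vw by simp
      next
        assume "i = l \<and> j = k"
        then have "weight w - weight u = 0" unfolding sum using uv vw by simp
        then show False using return uv vw by simp
      qed
    next
      case vw: (2 k l)
      then have "odd ((weight w - weight v) $ n) \<longleftrightarrow> n \<in> {k, l}" for n by (auto simp: axis_nth)
      from pair[OF sets[OF p1 this]] have "e k + e l = e i + e j" by (auto simp: add.commute)
      then have "weight w - weight v = (if is_red w then - (e i + e j) else e i + e j)"
        using vw(4) by simp
      \<comment> \<open>One index cancels and the other doubles, while \<open>u\<close> and
        \<open>w\<close> have different colours: a forbidden pair.\<close>
      then have "weight w - weight u = (if is_red w then - 2 *s e j else 2 *s e i)"
        unfolding sum uv(4) by (simp add: Finite_Cartesian_Product.vec_eq_iff)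
      then show False using mixed uv vw by (metis (full_types))
    qed
  next
    case uv: (2 i j)
    then have p1: "odd ((weight v - weight u) $ n) \<longleftrightarrow> n \<in> {i, j}" for n by (auto simp: axis_nth)
    show False using edges(2)
    proof (cases rule: edge_cases)
      case vw: (1 k l)
      then have "odd ((weight w - weight v) $ n) \<longleftrightarrow> n \<in> {k, l}" for n by (auto simp: axis_nth)
      from pair[OF sets[OF p1 this]] have "e i + e j = e k + e l" by (auto simp: add.commute)
      then have "weight v - weight u = (if is_red w then - (e k + e l) else e k + e l)"
        using uv(4) vw(3) by simp
      then have "weight w - weight u = (if is_red w then - 2 *s e l else 2 *s e k)"
        unfolding sum vw(4) by (simp add: Finite_Cartesian_Product.vec_eq_iff)
      then show False using mixed uv vw by (metis (full_types))
    next
      case vw: (2 k l)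
      then have "odd ((weight w - weight v) $ n) \<longleftrightarrow> n \<in> {k, l}" for n by (auto simp: axis_nth)
      from pair[OF sets[OF p1 this]] have "e i + e j = e k + e l" by (auto simp: add.commute)
      then have "weight w - weight u = 0" unfolding sum using uv vw by auto
      then show False using return uv vw by auto
    qed
  qed
qed

lemma cut_edge_exists:
  assumes "connected_graph A" "S \<subseteq> A" "S \<noteq> {}" "S \<noteq> A"
  shows "\<exists>v\<in>S. \<exists>u\<in>A - S. edge v u"
proof -
  obtain s a where s: "s \<in> S" and a: "a \<in> A" "a \<notin> S" using assms(2-4) by blast
  have "(s, a) \<in> {(p, q). p \<in> A \<and> q \<in> A \<and> edge p q}\<^sup>*"
    using assms(1,2) s a by (auto simp: connected_graph_def)
  then show ?thesis using a(2)
  proof (induction rule: rtrancl_induct)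
    case base then show ?case using s by blast
  next
    case (step p q) then show ?case by (cases "p \<in> S") auto
  qed
qed

section \<open>Evenness of the exponents\<close>

text \<open>Changing the sign of \<open>\<surd>\<xi>\<^sub>i\<close> conjugates the matrix by a diagonal matrix of signs, so the
  characteristic polynomial is even in every \<open>\<surd>\<xi>\<^sub>i\<close>.\<close>

definition flip_var :: "'m \<Rightarrow> 'm mpoly \<Rightarrow> 'm mpoly" where
  "flip_var i = mpoly_eval (\<lambda>j. if j = i then - var j else var j)"

interpretation flip_var: comm_ring_hom "flip_var i"
  unfolding flip_var_def by (rule mpoly_eval.comm_ring_hom_axioms)

lemma flip_var_var [simp]: "flip_var i (var j) = (if j = i then - var j else var j)"
  by (simp add: flip_var_def)

lemma lookup_flip_var:
  "Poly_Mapping.lookup (flip_var i f) k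
     = (if odd (Poly_Mapping.lookup k i) then - Poly_Mapping.lookup f k else Poly_Mapping.lookup f k)"
proof -
  have single: "flip_var i (Poly_Mapping.single l c)
      = Poly_Mapping.single l (if odd (Poly_Mapping.lookup l i) then - c else c)" for l c
  proof -
    have "(if j = i then - var j else var j :: 'a mpoly) ^ n
        = (if j = i \<and> odd n then - 1 else 1) * var j ^ n" for j n
      by (cases "even n") auto
    then have "monomial_eval (\<lambda>j. if j = i then - var j else var j :: 'a mpoly) l
        = (\<Prod>j\<in>Poly_Mapping.keys l. if j = i \<and> odd (Poly_Mapping.lookup l j) then - 1 else 1)
          * monomial_eval var l"
      unfolding monomial_eval_def by (simp add: prod.distrib)
    also have "(\<Prod>j\<in>Poly_Mapping.keys l. if j = i \<and> odd (Poly_Mapping.lookup l j) then - 1 else 1)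
        = (if odd (Poly_Mapping.lookup l i) then - 1 else 1 :: 'a mpoly)"
    proof (cases "i \<in> Poly_Mapping.keys l")
      case True
      then show ?thesis by (subst prod.remove[of _ i]) (auto intro!: prod.neutral)
    next
      case False
      then have "Poly_Mapping.lookup l i = 0" by (simp add: in_keys_iff)
      then show ?thesis by (auto intro!: prod.neutral)
    qed
    also have "monomial_eval var l = Poly_Mapping.single l (1 :: int)"
      unfolding var_def by (rule monomial_eval_var)
    finally show ?thesis
      unfolding flip_var_def mpoly_eval_single
      by (simp add: mult_single single_uminus flip: single_of_int)
  qed
  have "flip_var i f = (\<Sum>l\<in>Poly_Mapping.keys f. Poly_Mapping.single l
      (if odd (Poly_Mapping.lookup l i) then - Poly_Mapping.lookup f l else Poly_Mapping.lookup f l))"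
    by (subst mpoly_sum_single[of f]) (simp only: flip_var.hom_sum single)
  then show ?thesis
    by (auto simp: lookup_sum lookup_single when_def in_keys_iff)
qed

lemma flip_invariant_in_range:
  assumes "\<And>i. flip_var i f = f" shows "\<exists>h. f = sq_vars h"
proof -
  have even: "even (Poly_Mapping.lookup k i)" if "k \<in> Poly_Mapping.keys f" for k i
  proof (rule ccontr)
    assume "odd (Poly_Mapping.lookup k i)"
    then have "- Poly_Mapping.lookup f k = Poly_Mapping.lookup f k"
      using lookup_flip_var[of i f k] assms[of i] by simp
    then show False using that by (simp add: in_keys_iff)
  qed
  define half where "half k = Poly_Mapping.map (\<lambda>n. n div 2) k" for k :: "'a \<Rightarrow>\<^sub>0 nat"
  have "half k + half k = k" if "k \<in> Poly_Mapping.keys f" for k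
  proof (rule poly_mapping_eqI)
    fix i
    obtain n where "Poly_Mapping.lookup k i = 2 * n" using even[OF \<open>k \<in> _\<close>, of i] by blast
    then show "Poly_Mapping.lookup (half k + half k) i = Poly_Mapping.lookup k i"
      by (auto simp: half_def lookup_add map.rep_eq when_def)
  qed
  then have "f = sq_vars (\<Sum>k\<in>Poly_Mapping.keys f. Poly_Mapping.single (half k) (Poly_Mapping.lookup f k))"
    by (subst mpoly_sum_single[of f]) (simp add: sq_vars_sum sq_vars_single)
  then show ?thesis by blast
qed

text \<open>Diagonal of the conjugating sign matrix: by \<open>edge_parity\<close>, the parity of
  coordinate \<open>i\<close> changes along an edge exactly when \<open>var i\<close> occurs in its
  mark.\<close>

definition parity_sign :: "'m \<Rightarrow> 'm :: finite elt \<Rightarrow> 'm mpoly" where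
  "parity_sign i u = (if odd (weight u $ i) then - 1 else 1)"

lemma flip_var_entry:
  "flip_var i (entry u v) = parity_sign i u * entry u v * parity_sign i v"
proof (cases "u = v")
  case True
  have "flip_var i (xi_form a) = xi_form a" for a
    unfolding xi_form_def flip_var.hom_sum
    by (intro sum.cong refl) (simp add: flip_var.hom_mult flip_var.hom_power flip_var.hom_of_int)
  moreover have "parity_sign i u * y * parity_sign i u = y" for y
    by (simp add: parity_sign_def)
  ultimately show ?thesis using True by (simp add: entry_eq)
next
  case False
  have "flip_var i (edge_mark u v) = parity_sign i u * edge_mark u v * parity_sign i v"
  proof (cases "edge u v")
    case True
    then obtain k l where kl: "k \<noteq> l" "edge_mark u v = var k * var l"
      "\<And>n. odd ((weight v - weight u) $ n) \<longleftrightarrow> n \<in> {k, l}" by (rule edge_parity) blast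
    have "odd (weight v $ i) \<longleftrightarrow> (odd (weight u $ i) \<noteq> (i \<in> {k, l}))"
      using kl(3)[of i] by auto
    then show ?thesis using kl(1,2) by (auto simp: parity_sign_def flip_var.hom_mult)
  next
    case False
    then show ?thesis by (simp add: edge_mark_def)
  qed
  then show ?thesis using False
    by (simp add: entry_eq flip_var.hom_mult flip_var.hom_numeral flip_var.hom_uminus
        color_sign_def parity_sign_def)
qed

lemma char_poly_in_range:
  "\<exists>p. map_poly sq_vars p = char_poly (matrix_of_list vs)"
proof -
  let ?n = "length vs" and ?M = "matrix_of_list vs"
  have M: "?M \<in> carrier_mat ?n ?n" by (simp add: matrix_of_list_def)
  have flip: "map_poly (flip_var i) (char_poly ?M) = char_poly ?M" for i
  proof -
    define E where "E = Matrix.mat ?n ?n (\<lambda>(k, l). if k = l then parity_sign i (vs ! k) else 0)"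
    have E: "E \<in> carrier_mat ?n ?n" by (simp add: E_def)
    have left: "(E * B) $$ (k, l) = parity_sign i (vs ! k) * B $$ (k, l)"
      if "B \<in> carrier_mat ?n ?n" "k < ?n" "l < ?n" for B k l
      using that by (simp add: E_def scalar_prod_def if_distrib if_distribR cong: if_cong)
    have right: "(B * E) $$ (k, l) = B $$ (k, l) * parity_sign i (vs ! l)"
      if "B \<in> carrier_mat ?n ?n" "k < ?n" "l < ?n" for B k l
      using that by (simp add: E_def scalar_prod_def if_distrib if_distribR cong: if_cong)
    have "E * E = 1\<^sub>m ?n"
    proof (rule eq_matI)
      fix k l assume kl: "k < dim_row (1\<^sub>m ?n)" "l < dim_col (1\<^sub>m ?n)"
      then show "(E * E) $$ (k, l) = 1\<^sub>m ?n $$ (k, l)"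
        using left[OF E, of k l] by (auto simp: E_def parity_sign_def)
    qed (use E in auto)
    moreover have "map_mat (flip_var i) ?M = E * ?M * E"
    proof (rule eq_matI)
      fix k l assume "k < dim_row (E * ?M * E)" "l < dim_col (E * ?M * E)"
      then have kl: "k < ?n" "l < ?n" using E by auto
      have "E * ?M \<in> carrier_mat ?n ?n" using E M by simp
      from right[OF this kl] left[OF M kl]
      show "map_mat (flip_var i) ?M $$ (k, l) = (E * ?M * E) $$ (k, l)"
        using kl M by (simp add: flip_var_entry matrix_of_list_def)
    qed (use E M in auto)
    ultimately have "similar_mat (map_mat (flip_var i) ?M) ?M"
      using E M unfolding similar_mat_def similar_mat_wit_def
      by (intro exI[of _ E]) (simp add: Let_def)
    then have "char_poly (map_mat (flip_var i) ?M) = char_poly ?M" by (rule char_poly_similar)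
    then show ?thesis using flip_var.char_poly_hom[OF M] by simp
  qed
  have "\<exists>h. coeff (char_poly ?M) k = sq_vars h" for k
  proof (rule flip_invariant_in_range)
    show "flip_var i (coeff (char_poly ?M) k) = coeff (char_poly ?M) k" for i
      using arg_cong[OF flip[of i], of "\<lambda>p. coeff p k"] by (simp add: coeff_map_poly)
  qed
  then obtain h where h: "\<And>k. coeff (char_poly ?M) k = sq_vars (h k)" by metis
  define p where "p = (\<Sum>k\<le>degree (char_poly ?M). monom (h k) k)"
  have "coeff (map_poly sq_vars p) k = coeff (char_poly ?M) k" for k
  proof (cases "k \<le> degree (char_poly ?M)")
    case True
    then show ?thesis by (simp add: p_def coeff_map_poly sq_vars_zero coeff_sum h[symmetric])
  next
    case False
    then show ?thesis
      by (simp add: p_def coeff_map_poly sq_vars_zero coeff_sum coeff_eq_0)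
  qed
  then show ?thesis by (intro exI[of _ p] poly_eqI)
qed

section \<open>Cuts of the graph\<close>

definition var_index :: "'m :: finite \<Rightarrow> nat" where
  "var_index = (SOME g. inj g)"

lemma inj_var_index: "inj (var_index :: 'm :: finite \<Rightarrow> nat)"
proof -
  have "\<exists>g :: 'm \<Rightarrow> nat. inj g"
    using finite_imp_inj_to_nat_seg[of "UNIV :: 'm set"] by auto
  then show ?thesis unfolding var_index_def by (rule someI_ex)
qed

lemma var_index_eq_iff [simp]: "var_index i = var_index j \<longleftrightarrow> i = j"
  using inj_var_index by (auto dest: injD)

definition to_nat_mpoly :: "'m :: finite mpoly \<Rightarrow> nat mpoly" where
  "to_nat_mpoly = mpoly_eval (\<lambda>i. var (var_index i))"

interpretation to_nat_mpoly: comm_ring_hom to_nat_mpoly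
  unfolding to_nat_mpoly_def by (rule mpoly_eval.comm_ring_hom_axioms)

lemma to_nat_mpoly_var [simp]: "to_nat_mpoly (var i) = var (var_index i)"
  by (simp add: to_nat_mpoly_def)

lemma inj_to_nat_mpoly: "inj (to_nat_mpoly :: 'm :: finite mpoly \<Rightarrow> nat mpoly)"
proof (rule inj_on_inverseI)
  fix f :: "'m mpoly"
  have "mpoly_eval (\<lambda>n. var (inv_into UNIV var_index n)) (to_nat_mpoly f) = mpoly_eval var f"
    unfolding to_nat_mpoly_def mpoly_eval.hom_mpoly_eval
    by (simp add: inv_f_f[OF inj_var_index])
  then show "mpoly_eval (\<lambda>n. var (inv_into UNIV var_index n)) (to_nat_mpoly f) = f"
    by (simp add: mpoly_eval_id)
qed

section \<open>Linear forms and their divisibility by powers of 2\<close>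

abbreviation sq_var :: "'m :: finite \<Rightarrow> nat mpoly" where
  "sq_var i \<equiv> var (var_index i) ^ 2"

definition linear_form :: "int ^ 'm :: finite \<Rightarrow> nat mpoly" where
  "linear_form a = to_nat_mpoly (xi_form a)"

lemma linear_form_eq: "linear_form a = (\<Sum>i\<in>UNIV. of_int (a $ i) * sq_var i)"
  by (simp add: linear_form_def xi_form_def to_nat_mpoly.hom_sum to_nat_mpoly.hom_mult
      to_nat_mpoly.hom_power to_nat_mpoly.hom_of_int)

lemma linear_form_diff: "linear_form (a - b) = linear_form a - linear_form b"
  by (simp add: linear_form_eq algebra_simps sum_subtractf)

lemma linear_form_axis:
  "linear_form (e i - e j) = sq_var i - sq_var j"
  "linear_form (e i + e j) = sq_var i + sq_var j"
  "linear_form (- (e i + e j)) = - (sq_var i + sq_var j)"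
  by (simp_all add: linear_form_eq axis_nth algebra_simps sum.distrib sum_subtractf sum_negf
      if_distrib[of of_int] if_distrib[of "\<lambda>c. c * _"] cong: if_cong)

lemma var_power2: "var i ^ 2 = Poly_Mapping.single (Poly_Mapping.single i 2) 1"
  by (simp add: var_def power2_eq_square mult_single numeral_2_eq_2 flip: single_add)

lemma lookup_linear_form:
  "Poly_Mapping.lookup (linear_form a) (Poly_Mapping.single (var_index i) 2) = a $ i"
proof -
  have "of_int c * Poly_Mapping.single k 1 = Poly_Mapping.single k c" for c and k :: "nat \<Rightarrow>\<^sub>0 nat"
    by (simp add: mult_single flip: single_of_int)
  moreover have "Poly_Mapping.single (var_index j) (2 :: nat) = Poly_Mapping.single (var_index i) 2
      \<longleftrightarrow> j = i" for j
    by (metis lookup_single_eq lookup_single_not_eq var_index_eq_iff zero_neq_numeral)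
  ultimately show ?thesis
    by (simp add: linear_form_eq var_power2 lookup_sum lookup_single when_def)
qed

lemma dvd_linear_form: "2 ^ n dvd linear_form a \<Longrightarrow> 2 ^ n dvd a $ i"
  using lookup_linear_form[of a i] lookup_power_two_mult by (metis dvdE dvd_triv_left)

lemma linear_form_nonzero: "a \<noteq> 0 \<Longrightarrow> linear_form a \<noteq> 0"
  using lookup_linear_form[of a]
  by (metis Finite_Cartesian_Product.vec_eq_iff lookup_zero zero_index)

lemma not_two_dvd_var: "\<not> 2 dvd (var i :: nat mpoly)"
proof
  assume "2 dvd (var i :: nat mpoly)"
  then obtain h :: "nat mpoly" where "var i = 2 ^ 1 * h" by (metis dvdE power_one_right)
  then have "Poly_Mapping.lookup (var i) (Poly_Mapping.single i 1) = 2 ^ 1 * Poly_Mapping.lookup h (Poly_Mapping.single i 1)"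
    by (simp only: lookup_power_two_mult)
  then show False by (simp add: var_def) presburger
qed

lemma not_two_dvd_mult: "\<not> 2 dvd f \<Longrightarrow> \<not> 2 dvd g \<Longrightarrow> \<not> 2 dvd f * (g :: nat mpoly)"
  using two_prime_mpoly by blast

lemma not_two_dvd_prod: "(\<And>p. p \<in> E \<Longrightarrow> \<not> 2 dvd f p) \<Longrightarrow> \<not> 2 dvd (prod f E :: nat mpoly)"
  by (induction E rule: infinite_finite_induct)
    (simp_all add: not_two_dvd_one_mpoly not_two_dvd_mult)

lemma not_two_dvd_var_sum:
  assumes "i \<noteq> j" "s = 1 \<or> s = - 1" shows "\<not> 2 dvd (var i ^ 2 + s * var j ^ 2 :: nat mpoly)"
proof
  assume "2 dvd (var i ^ 2 + s * var j ^ 2 :: nat mpoly)"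
  then obtain h :: "nat mpoly" where h: "var i ^ 2 + s * var j ^ 2 = 2 ^ 1 * h"
    by (metis dvdE power_one_right)
  let ?k = "Poly_Mapping.single i (2 :: nat)"
  have "Poly_Mapping.single j (2 :: nat) \<noteq> ?k"
    using assms(1) by (metis lookup_single_eq lookup_single_not_eq zero_neq_numeral)
  then have "Poly_Mapping.lookup (var i ^ 2 + s * var j ^ 2) ?k = 1"
    using assms(2) by (auto simp: var_power2 lookup_add lookup_minus lookup_single)
  then have "1 = 2 * Poly_Mapping.lookup h ?k" unfolding h lookup_power_two_mult by simp
  then show False by presburger
qed

text \<open>After multiplication by all denominators, every term but that of \<open>q\<close>
  contains \<open>den q\<close>; these terms make up \<open>den q * z\<close>. A substitution
  annihilating \<open>den q\<close> will then isolate the term of \<open>q\<close>.\<close>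

lemma clear_denominators:
  fixes num den :: "'p \<Rightarrow> nat mpoly"
  assumes "finite E" and nz: "\<And>p. p \<in> E \<Longrightarrow> den p \<noteq> 0"
    and int: "frac_of L + (\<Sum>p\<in>E. frac_of (num p) / frac_of (den p)) \<in> pow_ideal n"
    and q: "q \<in> E"
  shows "\<exists>z. 2 ^ n dvd num q * prod den (E - {q}) + den q * z"
proof -
  have fnz: "frac_of (den p) \<noteq> 0" if "p \<in> E" for p
    using nz[OF that] frac_of_inj[of "den p" 0] frac_of.hom_zero by metis
  have split: "prod den E = den p * prod den (E - {p})" if "p \<in> E" for p
    using prod.remove[OF assms(1) that] .
  define T where "T = L * prod den E + (\<Sum>p\<in>E. num p * prod den (E - {p}))"
  have "frac_of (prod den E) * (frac_of (num p) / frac_of (den p)) = frac_of (num p * prod den (E - {p}))"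
    if "p \<in> E" for p
    using fnz[OF that] unfolding split[OF that] frac_of.hom_mult
    by (simp del: mult_fract divide_fract)
  then have "frac_of T = frac_of (prod den E) * (frac_of L + (\<Sum>p\<in>E. frac_of (num p) / frac_of (den p)))"
    unfolding T_def frac_of.hom_add frac_of.hom_sum distrib_left sum_distrib_left
    by (simp add: mult.commute frac_of.hom_mult[of L "prod den E"] del: mult_fract divide_fract)
  then have "frac_of T \<in> pow_ideal n"
    using R_mult_pow_ideal[OF frac_of_R int] by simp
  then have "2 ^ n dvd T" by (simp only: frac_of_pow_ideal_iff)
  define z where "z = L * prod den (E - {q}) + (\<Sum>p\<in>E - {q}. num p * prod den (E - {q} - {p}))"
  have "num p * prod den (E - {p}) = den q * (num p * prod den (E - {q} - {p}))" if "p \<in> E - {q}" for p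
  proof -
    have "prod den (E - {p}) = den q * prod den (E - {p} - {q})"
      using that q assms(1) by (intro prod.remove) auto
    moreover have "E - {p} - {q} = E - {q} - {p}" by blast
    ultimately show ?thesis by (simp add: mult.left_commute)
  qed
  then have "(\<Sum>p\<in>E - {q}. num p * prod den (E - {p}))
      = (\<Sum>p\<in>E - {q}. den q * (num p * prod den (E - {q} - {p})))"
    by (intro sum.cong refl)
  then have "(\<Sum>p\<in>E. num p * prod den (E - {p}))
      = num q * prod den (E - {q}) + den q * (\<Sum>p\<in>E - {q}. num p * prod den (E - {q} - {p}))"
    unfolding sum.remove[OF assms(1) q] by (simp only: sum_distrib_left)
  then have "T = num q * prod den (E - {q}) + den q * z"
    unfolding T_def z_def split[OF q] by (simp add: algebra_simps)
  then show ?thesis using \<open>2 ^ n dvd T\<close> by metis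
qed

text \<open>With \<open>cut_den\<close>, numerator and denominator of the second order term
  \<open>c v u * c u v / (d v - d u)\<close>.\<close>

definition cut_num :: "'m :: finite elt \<times> 'm elt \<Rightarrow> nat mpoly" where
  "cut_num = (\<lambda>(v, u). color_sign v * color_sign u * to_nat_mpoly (edge_mark v u) ^ 2)"

definition cut_den :: "'m :: finite elt \<times> 'm elt \<Rightarrow> nat mpoly" where
  "cut_den = (\<lambda>(v, u). linear_form (weight v - weight u))"

lemma cut_edge_data:
  assumes "edge v u"
  obtains i j s where "i \<noteq> j" "s = 1 \<or> s = - 1" "is_red u = is_red v"
      "weight v - weight u = of_int s *s (e i - e j)"
      "cut_num (v, u) = sq_var i * sq_var j" "cut_den (v, u) = of_int s * (sq_var i - sq_var j)"
    | i j s where "i \<noteq> j" "s = 1 \<or> s = - 1" "is_red u \<noteq> is_red v"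
      "weight v - weight u = of_int s *s (e i + e j)"
      "cut_num (v, u) = - (sq_var i * sq_var j)" "cut_den (v, u) = of_int s * (sq_var i + sq_var j)"
  using assms
proof (cases rule: edge_cases)
  case (1 i j)
  have "weight v - weight u = e j - e i" using 1(4) by (metis minus_diff_eq)
  moreover have "cut_num (v, u) = sq_var j * sq_var i"
    using 1 by (auto simp: cut_num_def color_sign_def to_nat_mpoly.hom_mult power_mult_distrib)
  ultimately show thesis
    using 1 by (intro that(1)[of j i 1]) (simp_all add: cut_den_def linear_form_axis)
next
  case (2 i j)
  have "cut_num (v, u) = - (sq_var i * sq_var j)"
    using 2 by (auto simp: cut_num_def color_sign_def to_nat_mpoly.hom_mult power_mult_distrib)
  moreover have "weight v - weight u = of_int (if is_red u then 1 else - 1) *s (e i + e j)"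
    using 2(4) by (auto simp: Finite_Cartesian_Product.vec_eq_iff algebra_simps)
  moreover from this have "cut_den (v, u) = of_int (if is_red u then 1 else - 1) * (sq_var i + sq_var j)"
    by (auto simp: cut_den_def linear_form_axis(2) linear_form_eq algebra_simps sum.distrib sum_negf axis_nth
      if_distrib[of of_int] if_distrib[of "\<lambda>c. c * _"] cong: if_cong)
  ultimately show thesis
    using 2 by (intro that(2)[of i j "if is_red u then 1 else - 1"]) auto
qed

lemma four_eq_mpoly: "(4 :: nat mpoly) = 2 * 2"
  by (metis mult_2 numeral_Bit0)

lemma four_dvd_mpolyE:
  assumes "4 dvd (f :: nat mpoly)" obtains y where "f = 2 * (2 * y)"
proof -
  from assms obtain y where "f = 4 * y" by blast
  then have "f = 2 * (2 * y)" unfolding four_eq_mpoly by (simp only: mult.assoc)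
  then show thesis by (rule that)
qed

lemma four_dvd_two_mult_mpoly:
  assumes "4 dvd 2 * (f :: nat mpoly)" shows "2 dvd f"
proof -
  obtain y where "2 * f = 2 * (2 * y)" using assms by (rule four_dvd_mpolyE)
  then have "f = 2 * y" using two_mpoly_nonzero by (simp only: mult_cancel_left) blast
  then show ?thesis by (metis dvd_triv_left)
qed

lemma four_eq_square_mpoly: "(2 :: nat mpoly) ^ 2 = 4"
  unfolding power2_eq_square four_eq_mpoly ..

text \<open>Clear the denominators and identify \<open>\<xi>\<^sub>l\<close> with \<open>\<xi>\<^sub>k\<close> for a cut edge with indices \<open>k\<close> and \<open>l\<close>. If it
  is the only one with these indices, only its own term survives modulo 2. Otherwise there are two,
  with denominators \<open>\<plusminus>(\<xi>\<^sub>k - \<xi>\<^sub>l)\<close> and \<open>\<plusminus>(\<xi>\<^sub>k + \<xi>\<^sub>l)\<close>; then only the term of the first survives, and it is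
  divisible by 2 but not by 4.\<close>

lemma no_integral_cut:
  assumes A: "is_graph A" "connected_graph A" "nondegenerate A"
    and S: "S \<subseteq> A" "S \<noteq> {}" "S \<noteq> A"
    and int: "frac_of L + (\<Sum>p\<in>S \<times> (A - S). frac_of (cut_num p) / frac_of (cut_den p)) \<in> pow_ideal 2"
  shows False
proof -
  have finA: "finite A" using A(1) by (simp add: is_graph_def)
  define E where "E = {p \<in> S \<times> (A - S). edge (fst p) (snd p)}"
  have fin: "finite (S \<times> (A - S))" using finA S(1) finite_subset by blast
  then have finE: "finite E" by (simp add: E_def)
  have EA: "fst p \<in> A" "snd p \<in> A" "fst p \<in> S" "snd p \<notin> S" "fst p \<noteq> snd p" if "p \<in> E" for p
    using that S(1) edge_neq by (auto simp: E_def)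
  have "(\<Sum>p\<in>S \<times> (A - S). frac_of (cut_num p) / frac_of (cut_den p))
      = (\<Sum>p\<in>E. frac_of (cut_num p) / frac_of (cut_den p))"
  proof (rule sum.mono_neutral_right[OF fin])
    show "\<forall>p\<in>S \<times> (A - S) - E. frac_of (cut_num p) / frac_of (cut_den p) = 0"
    proof
      fix p assume "p \<in> S \<times> (A - S) - E"
      then have "cut_num p = 0" by (cases p) (auto simp: E_def cut_num_def edge_mark_def)
      then show "frac_of (cut_num p) / frac_of (cut_den p) = 0"
        by (simp only: frac_of.hom_zero div_0)
    qed
  qed (auto simp: E_def)
  then have intE: "frac_of L + (\<Sum>p\<in>E. frac_of (cut_num p) / frac_of (cut_den p)) \<in> pow_ideal 2"
    using int by simp
  have nz: "cut_den p \<noteq> 0" if p: "p \<in> E" for p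
  proof -
    have "weight (fst p) \<noteq> weight (snd p)"
      using weight_diff_unique[OF A(1,3) EA(1,2)[OF p] EA(1,1)[OF p] EA(5)[OF p]] EA(5)[OF p] by auto
    then show ?thesis
      using linear_form_nonzero[of "weight (fst p) - weight (snd p)"]
      by (simp add: cut_den_def case_prod_beta)
  qed
  define same where "same p \<longleftrightarrow> is_red (snd p) = is_red (fst p)" for p :: "'a elt \<times> 'a elt"
  define edge_data where "edge_data p i j s \<longleftrightarrow> i \<noteq> j \<and> (s = 1 \<or> s = - 1) \<and>
      weight (fst p) - weight (snd p) = of_int s *s (if same p then e i - e j else e i + e j) \<and>
      cut_num p = (if same p then 1 else - 1) * (sq_var i * sq_var j) \<and>
      cut_den p = of_int s * (sq_var i + (if same p then - 1 else 1) * sq_var j)"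
    for p :: "'a elt \<times> 'a elt" and i j s
  have "\<exists>i j s. edge_data p i j s" if p: "p \<in> E" for p
  proof -
    have "edge (fst p) (snd p)" using p by (simp add: E_def)
    then show ?thesis
    proof (cases rule: cut_edge_data)
      case (1 i j s)
      then show ?thesis by (intro exI[of _ i] exI[of _ j] exI[of _ s]) (simp add: edge_data_def same_def)
    next
      case (2 i j s)
      then show ?thesis by (intro exI[of _ i] exI[of _ j] exI[of _ s]) (simp add: edge_data_def same_def)
    qed
  qed
  then obtain I J s where "\<And>p. p \<in> E \<Longrightarrow> edge_data p (I p) (J p) (s p)" by metis
  then have IJ: "\<And>p. p \<in> E \<Longrightarrow> I p \<noteq> J p"
    and s: "\<And>p. p \<in> E \<Longrightarrow> s p = 1 \<or> s p = - 1"
    and wt: "\<And>p. p \<in> E \<Longrightarrow> weight (fst p) - weight (snd p)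
        = of_int (s p) *s (if same p then e (I p) - e (J p) else e (I p) + e (J p))"
    and num: "\<And>p. p \<in> E \<Longrightarrow> cut_num p = (if same p then 1 else - 1) * (sq_var (I p) * sq_var (J p))"
    and den: "\<And>p. p \<in> E \<Longrightarrow> cut_den p = of_int (s p) * (sq_var (I p) + (if same p then - 1 else 1) * sq_var (J p))"
    unfolding edge_data_def by blast+
  obtain v u where "v \<in> S" "u \<in> A - S" "edge v u"
    using cut_edge_exists[OF A(2) S] by blast
  then obtain p0 where p0: "p0 \<in> E" using E_def by fastforce
  define k where "k = I p0"
  define l where "l = J p0"
  define G where "G = {p \<in> E. {I p, J p} = {k, l}}"
  have G_sub: "G \<subseteq> E" and p0_G: "p0 \<in> G" using p0 by (auto simp: G_def k_def l_def)
  have G_unique: "p = q" if pq: "p \<in> G" "q \<in> G" "same p = same q" for p q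
  proof -
    have pE: "p \<in> E" and qE: "q \<in> E" using pq G_sub by auto
    have IJ': "I p = I q \<and> J p = J q \<or> I p = J q \<and> J p = I q"
      using pq(1,2) by (auto simp: G_def doubleton_eq_iff)
    have "weight (fst p) - weight (snd p) = weight (fst q) - weight (snd q) \<or>
        weight (fst p) - weight (snd p) = weight (snd q) - weight (fst q)"
    proof -
      have "weight (snd q) - weight (fst q) = - (weight (fst q) - weight (snd q))" by simp
      then show ?thesis
        unfolding wt[OF pE] wt[OF qE] using IJ' s[OF pE] s[OF qE] pq(3)
        by (auto simp: Finite_Cartesian_Product.vec_eq_iff)
    qed
    then have "fst p = fst q \<and> snd p = snd q \<or> fst p = snd q \<and> snd p = fst q"
      using weight_diff_unique[OF A(1,3) EA(1,2)[OF pE]] EA(5)[OF pE] EA(1,2)[OF qE] by metis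
    \<comment> \<open>All pairs are directed from \<open>S\<close> to its complement, so
      \<open>p\<close> is not the reverse of \<open>q\<close>.\<close>
    moreover have "fst p \<noteq> snd q" using EA(3)[OF pE] EA(4)[OF qE] by metis
    ultimately show ?thesis by (simp add: prod_eq_iff)
  qed
  define \<sigma> where "\<sigma> i = (if i = l then k else i)" for i
  define \<rho> :: "nat mpoly \<Rightarrow> nat mpoly"
    where "\<rho> = mpoly_eval (\<lambda>n. var (if n = var_index l then var_index k else n))"
  interpret \<rho>: comm_ring_hom \<rho>
    unfolding \<rho>_def by (rule mpoly_eval.comm_ring_hom_axioms)
  have \<rho>_var: "\<rho> (var (var_index i)) = var (var_index (\<sigma> i))" for i
    by (simp add: \<rho>_def \<sigma>_def)
  have \<rho>_den: "\<rho> (cut_den p) = of_int (s p) *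
      (sq_var (\<sigma> (I p)) + (if same p then - 1 else 1) * sq_var (\<sigma> (J p)))" if "p \<in> E" for p
    unfolding den[OF that]
    by (simp add: \<rho>.hom_mult \<rho>.hom_add \<rho>.hom_power \<rho>.hom_of_int \<rho>.hom_uminus \<rho>_var)
  have unit: "\<not> 2 dvd of_int (s p) * f" if "p \<in> E" "\<not> 2 dvd f" for p and f :: "nat mpoly"
    using s[OF that(1)] that(2) by auto
  have \<rho>_num: "\<not> 2 dvd \<rho> (cut_num p)" if p: "p \<in> E" for p
  proof -
    have "\<not> 2 dvd sq_var i * sq_var j" for i j :: 'a
      unfolding power2_eq_square by (intro not_two_dvd_mult not_two_dvd_var)
    then show ?thesis unfolding num[OF p]
      by (simp add: \<rho>.hom_mult \<rho>.hom_power \<rho>.hom_uminus \<rho>_var)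
  qed
  have outside: "\<not> 2 dvd \<rho> (cut_den p)" if p: "p \<in> E - G" for p
  proof -
    have pE: "p \<in> E" and "{I p, J p} \<noteq> {k, l}" using p by (auto simp: G_def)
    then have "\<sigma> (I p) \<noteq> \<sigma> (J p)" using IJ[OF pE] by (auto simp: \<sigma>_def)
    then have "\<not> 2 dvd sq_var (\<sigma> (I p)) + (if same p then - 1 else 1) * sq_var (\<sigma> (J p))"
      by (intro not_two_dvd_var_sum) auto
    then show ?thesis unfolding \<rho>_den[OF pE] by (rule unit[OF pE])
  qed
  have inside: "\<rho> (cut_den p) = (if same p then 0 else of_int (s p) * (2 * sq_var k))" if p: "p \<in> G" for p
  proof -
    have pE: "p \<in> E" using p G_sub by blast
    have "\<sigma> (I p) = k" "\<sigma> (J p) = k" using p by (auto simp: G_def \<sigma>_def doubleton_eq_iff)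
    then show ?thesis unfolding \<rho>_den[OF pE] by simp
  qed
  have outside_prod: "\<not> 2 dvd (\<Prod>p\<in>E - G. \<rho> (cut_den p))"
    by (rule not_two_dvd_prod) (rule outside)
  have dvd: "\<exists>z. 4 dvd \<rho> (cut_num q) * (\<Prod>p\<in>E - {q}. \<rho> (cut_den p)) + \<rho> (cut_den q) * z"
    if q: "q \<in> E" for q
  proof -
    obtain z where "2 ^ 2 dvd cut_num q * prod cut_den (E - {q}) + cut_den q * z"
      using clear_denominators[OF finE nz intE q] by blast
    then obtain y where "cut_num q * prod cut_den (E - {q}) + cut_den q * z = 2 ^ 2 * y" by blast
    from arg_cong[OF this, of \<rho>]
    have "\<rho> (cut_num q) * (\<Prod>p\<in>E - {q}. \<rho> (cut_den p)) + \<rho> (cut_den q) * \<rho> z = 2 ^ 2 * \<rho> y"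
      by (simp only: \<rho>.hom_add \<rho>.hom_mult \<rho>.hom_prod \<rho>.hom_power \<rho>.hom_numeral)
    then show ?thesis by (intro exI[of _ "\<rho> z"]) (metis dvd_triv_left four_eq_square_mpoly)
  qed
  show False
  proof (cases "\<exists>b\<in>G. same b")
    case True
    then obtain b where b: "b \<in> G" "same b" by blast
    then have bE: "b \<in> E" using G_sub by blast
    obtain z where z: "4 dvd \<rho> (cut_num b) * (\<Prod>p\<in>E - {b}. \<rho> (cut_den p)) + \<rho> (cut_den b) * z"
      using dvd[OF bE] by blast
    have zero: "\<rho> (cut_den b) = 0" using inside[OF b(1)] b(2) by simp
    have z: "4 dvd \<rho> (cut_num b) * (\<Prod>p\<in>E - {b}. \<rho> (cut_den p))"
      using z unfolding zero by simp
    have two_four: "2 dvd f" if four: "4 dvd f" for f :: "nat mpoly"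
      using four by (rule four_dvd_mpolyE) (metis dvd_triv_left)
    show False
    proof (cases "G = {b}")
      case True
      then show False using two_four[OF z] not_two_dvd_mult[OF \<rho>_num[OF bE] outside_prod] by simp
    next
      case False
      then obtain r where r: "r \<in> G" "r \<noteq> b" using b(1) by blast
      then have nsame: "\<not> same r" using G_unique[of r b] b by blast
      \<comment> \<open>By \<open>G_unique\<close> at most one pair in \<open>G\<close> has equal
        colours and at most one has different colours.\<close>
      have "G = {b, r}"
        using G_unique r b nsame by blast
      then have "E - {b} = insert r (E - G)" "r \<notin> E - G" using r G_sub by auto
      then have "(\<Prod>p\<in>E - {b}. \<rho> (cut_den p)) = \<rho> (cut_den r) * (\<Prod>p\<in>E - G. \<rho> (cut_den p))"
        using finE by simp
      \<comment> \<open>The only even denominator left, with exactly one factor 2: a congruence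
        modulo 2 would give no contradiction here.\<close>
      also have "\<rho> (cut_den r) = of_int (s r) * (2 * sq_var k)"
        using inside[OF r(1)] nsame by simp
      finally have eq: "\<rho> (cut_num b) * (\<Prod>p\<in>E - {b}. \<rho> (cut_den p)) = 2 * (\<rho> (cut_num b) *
          ((of_int (s r) * sq_var k) * (\<Prod>p\<in>E - G. \<rho> (cut_den p))))"
        by (simp only: ac_simps)
      have "2 dvd \<rho> (cut_num b) * ((of_int (s r) * sq_var k) * (\<Prod>p\<in>E - G. \<rho> (cut_den p)))"
        using z unfolding eq by (rule four_dvd_two_mult_mpoly)
      moreover have odd: "\<not> 2 dvd of_int (s r) * sq_var k"
        unfolding power2_eq_square
        by (intro unit not_two_dvd_mult not_two_dvd_var) (use r G_sub in auto)
      ultimately show False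
        using not_two_dvd_mult[OF \<rho>_num[OF bE] not_two_dvd_mult[OF odd outside_prod]] by blast
    qed
  next
    case False
    then have G: "G = {p0}" using G_unique p0_G by blast
    obtain z where z: "4 dvd \<rho> (cut_num p0) * (\<Prod>p\<in>E - {p0}. \<rho> (cut_den p)) + \<rho> (cut_den p0) * z"
      using dvd[OF p0] by blast
    have "2 dvd \<rho> (cut_num p0) * (\<Prod>p\<in>E - {p0}. \<rho> (cut_den p)) + \<rho> (cut_den p0) * z"
      using z by (rule four_dvd_mpolyE) (metis dvd_triv_left)
    \<comment> \<open>A denominator with a plus sign does not vanish under the identification, it
      only becomes even; the other terms are therefore discarded modulo 2.\<close>
    moreover have "\<rho> (cut_den p0) = 2 * (of_int (s p0) * sq_var k)"
      using inside[OF p0_G] False p0_G by (simp add: ac_simps)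
    then have "2 dvd \<rho> (cut_den p0) * z" by (metis dvd_mult2 dvd_triv_left)
    ultimately have "2 dvd \<rho> (cut_num p0) * (\<Prod>p\<in>E - {p0}. \<rho> (cut_den p))"
      by (simp only: dvd_add_left_iff)
    then show False using not_two_dvd_mult[OF \<rho>_num[OF p0] outside_prod] G by simp
  qed
qed

section \<open>Irreducibility\<close>

text \<open>A factor of intermediate degree would yield, by \<open>factor_trace\<close>, a nonempty
  proper set of vertices contradicting \<open>no_integral_cut\<close>. The separation hypotheses of
  \<open>perturbed_diagonal\<close> come from \<open>weight_diff_not_four_dvd\<close>,
  \<open>edge_parity\<close> and \<open>two_path_parity\<close>.\<close>

lemma monic_factor_trivial:
  fixes A :: "'m :: finite elt set"
  assumes A: "is_graph A" "connected_graph A" "nondegenerate A" "allowable A"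
    and vs: "distinct vs" "set vs = A"
    and pq: "p * q = map_poly to_nat_mpoly (char_poly (matrix_of_list vs))"
    and monic: "lead_coeff p = 1" "lead_coeff q = 1"
  shows "degree p = 0 \<or> degree q = 0"
proof (rule ccontr)
  assume "\<not> ?thesis"
  then have deg: "degree p > 0" "degree q > 0" by auto
  let ?N = "length vs"
  define d where "d u = frac_of (linear_form (weight (vs ! u)))" for u
  define m where "m u v = to_nat_mpoly (edge_mark (vs ! u) (vs ! v))" for u v
  define c where "c u v = frac_of (color_sign (vs ! v) * m u v)" for u v
  have vs_A: "vs ! u \<in> A" if "u < ?N" for u using that vs by auto
  have vs_neq: "vs ! u \<noteq> vs ! v" if "u < ?N" "v < ?N" "u \<noteq> v" for u v
    using that vs(1) by (simp add: nth_eq_iff_index_eq)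
  have m_sym: "m u v = m v u" for u v by (simp add: m_def edge_mark_sym)
  have m_edge: "edge (vs ! u) (vs ! v)" if "c u v \<noteq> 0" for u v
  proof (rule ccontr)
    assume "\<not> edge (vs ! u) (vs ! v)"
    then have "m u v = 0" by (simp add: m_def edge_mark_def)
    then show False using that by (simp add: c_def fract_collapse)
  qed
  have m_zero: "m u v = 0" if "c u v = 0" for u v
  proof -
    have "color_sign (vs ! v) * m u v = 0"
      using that frac_of_inj[of "color_sign (vs ! v) * m u v" 0] by (simp add: c_def fract_collapse)
    then show ?thesis by (auto simp: color_sign_def split: if_splits)
  qed
  have d_diff: "d u - d v = frac_of (linear_form (weight (vs ! u) - weight (vs ! v)))" for u v
    by (simp only: d_def linear_form_diff frac_of.hom_minus)
  interpret perturbed_diagonal odd_denominators ?N d c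
  proof
    fix u v w assume u: "u < ?N" and w: "w < ?N"
    show "d u \<in> odd_denominators" unfolding d_def by (rule frac_of_R)
    show "c u w \<in> odd_denominators" unfolding c_def by (rule frac_of_R)
    show "c u u = 0"
      using m_edge[of u u] edge_neq by blast
    show "c w u = 0" if "c u w = 0"
      using m_zero[OF that] m_sym[of w u] by (simp add: c_def fract_collapse)
    \<comment> \<open>Both orientations collect the colour sign of each of the three vertices once,
      and the marks are symmetric.\<close>
    show "c u v * c v w * c w u = c u w * c w v * c v u"
      unfolding c_def frac_of.hom_mult[symmetric] m_sym[of u w] m_sym[of w v] m_sym[of v u]
      by (simp only: ac_simps)
    show "d u - d w \<notin> pow_ideal 2" if "u \<noteq> w"
    proof
      assume "d u - d w \<in> pow_ideal 2"
      then have "2 ^ 2 dvd linear_form (weight (vs ! u) - weight (vs ! w))"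
        by (simp only: d_diff frac_of_pow_ideal_iff)
      then have "2 ^ 2 dvd (weight (vs ! u) - weight (vs ! w)) $ i" for i
        by (rule dvd_linear_form)
      then show False
        using weight_diff_not_four_dvd[OF A(1-3) vs_A[OF u] vs_A[OF w] vs_neq[OF u w that]] by simp
    qed
    show "d u - d w \<notin> pow_ideal 1" if cuw: "c u w \<noteq> 0"
    proof
      assume "d u - d w \<in> pow_ideal 1"
      then have "2 ^ 1 dvd linear_form (weight (vs ! u) - weight (vs ! w))"
        by (simp only: d_diff frac_of_pow_ideal_iff)
      then have even: "2 ^ 1 dvd (weight (vs ! u) - weight (vs ! w)) $ i" for i
        by (rule dvd_linear_form)
      obtain i where "odd ((weight (vs ! w) - weight (vs ! u)) $ i)"
        using m_edge[OF cuw] by (elim edge_parity) blast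
      then show False using even[of i] by simp
    qed
    show "d u - d w \<notin> pow_ideal 1" if "v < ?N" "u \<noteq> w" "c u v \<noteq> 0" "c v w \<noteq> 0"
    proof
      assume "d u - d w \<in> pow_ideal 1"
      then have "2 ^ 1 dvd linear_form (weight (vs ! u) - weight (vs ! w))"
        by (simp only: d_diff frac_of_pow_ideal_iff)
      then have even: "2 ^ 1 dvd (weight (vs ! u) - weight (vs ! w)) $ i" for i
        by (rule dvd_linear_form)
      then show False
        using two_path_parity[OF A(1,3,4) vs_A[OF u] vs_A[OF that(1)] vs_A[OF w]
            m_edge[OF that(3)] m_edge[OF that(4)] vs_neq[OF u w that(2)]] by simp
    qed
  qed
  define P where "P = map_poly frac_of p"
  define Q where "Q = map_poly frac_of q"
  interpret frac_inj: inj_comm_ring_hom frac_of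
    by unfold_locales (metis frac_of_inj frac_of.hom_zero)
  interpret frac_poly: map_poly_inj_comm_ring_hom frac_of ..
  have M: "matrix_of_list vs \<in> carrier_mat ?N ?N" by (simp add: matrix_of_list_def)
  have "map_mat frac_of (map_mat to_nat_mpoly (matrix_of_list vs)) = perturbed_matrix"
  proof (rule eq_matI)
    fix u v assume "u < dim_row perturbed_matrix" "v < dim_col perturbed_matrix"
    then have u: "u < ?N" and v: "v < ?N" by (simp_all add: perturbed_matrix_def)
    have "frac_of (to_nat_mpoly (entry (vs ! u) (vs ! v))) = (if u = v then d u else 2 * c u v)"
    proof (cases "u = v")
      case True
      then show ?thesis by (simp add: entry_eq d_def linear_form_def)
    next
      case False
      have sign: "to_nat_mpoly (color_sign (vs ! v)) = color_sign (vs ! v)"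
        by (simp add: color_sign_def to_nat_mpoly.hom_uminus)
      then show ?thesis
        using False vs_neq[OF u v False]
        by (simp only: entry_eq c_def m_def if_False sign to_nat_mpoly.hom_mult to_nat_mpoly.hom_numeral
            frac_of.hom_mult frac_of.hom_numeral)
    qed
    then show "map_mat frac_of (map_mat to_nat_mpoly (matrix_of_list vs)) $$ (u, v) = perturbed_matrix $$ (u, v)"
      using u v by (simp add: matrix_of_list_def perturbed_matrix_def)
  qed (simp_all add: matrix_of_list_def perturbed_matrix_def)
  then have "P * Q = char_poly perturbed_matrix"
    using frac_of.char_poly_hom[of "map_mat to_nat_mpoly (matrix_of_list vs)" ?N]
      to_nat_mpoly.char_poly_hom[OF M] M pq
    by (simp add: P_def Q_def flip: frac_poly.hom_mult)
  moreover have "degree P = degree p" "lead_coeff P = 1" "lead_coeff Q = 1"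
    using monic by (simp_all add: P_def Q_def fract_collapse)
  moreover have "coeff P k = frac_of (coeff p k)" "coeff Q k = frac_of (coeff q k)" for k
    by (simp_all add: P_def Q_def)
  ultimately obtain S where S: "S \<subseteq> {..<?N}" "card S = degree p"
    and trace: "coeff P (degree p - 1) + sum d S +
      4 * (\<Sum>v\<in>S. \<Sum>u\<in>{..<?N} - S. c v u * c u v / (d v - d u)) \<in> pow_ideal 4"
    using factor_trace[of P Q] deg frac_of_R by auto
  define S' where "S' = (\<lambda>u. vs ! u) ` S"
  have inj: "inj_on (\<lambda>u. vs ! u) {..<?N}"
    using vs(1) by (auto simp: inj_on_def nth_eq_iff_index_eq)
  have image: "(\<lambda>u. vs ! u) ` {..<?N} = A"
    using vs(2) by (auto simp: in_set_conv_nth image_iff)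
  have compl: "(\<lambda>u. vs ! u) ` ({..<?N} - S) = A - S'"
    unfolding S'_def image[symmetric] using inj S(1) by (simp add: inj_on_image_set_diff[OF inj])
  have cut: "(\<Sum>v\<in>S. \<Sum>u\<in>{..<?N} - S. c v u * c u v / (d v - d u))
      = (\<Sum>x\<in>S' \<times> (A - S'). frac_of (cut_num x) / frac_of (cut_den x))"
  proof -
    have "c v u * c u v / (d v - d u)
        = frac_of (cut_num (vs ! v, vs ! u)) / frac_of (cut_den (vs ! v, vs ! u))" for v u
    proof -
      have "c v u * c u v = frac_of (cut_num (vs ! v, vs ! u))"
        unfolding c_def frac_of.hom_mult[symmetric] cut_num_def m_sym[of u v]
        by (simp add: m_def power2_eq_square ac_simps)
      then show ?thesis unfolding d_diff cut_den_def by simp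
    qed
    moreover have "(\<Sum>x\<in>S' \<times> (A - S'). f x) = (\<Sum>v\<in>S. \<Sum>u\<in>{..<?N} - S. f (vs ! v, vs ! u))"
      for f :: "_ \<Rightarrow> nat mpoly fract"
    proof -
      have "(\<Sum>x\<in>S' \<times> (A - S'). f x) = (\<Sum>v\<in>S'. \<Sum>u\<in>A - S'. f (v, u))"
        by (simp add: sum.cartesian_product)
      then show ?thesis
        unfolding compl[symmetric] unfolding S'_def
        by (simp add: sum.reindex[OF inj_on_subset[OF inj S(1)]]
            sum.reindex[OF inj_on_subset[OF inj Diff_subset[of _ S]]])
    qed
    ultimately show ?thesis by simp
  qed
  define sig where "sig = (\<Sum>x\<in>S' \<times> (A - S'). frac_of (cut_num x) / frac_of (cut_den x))"
  define trace_coeff where "trace_coeff = coeff p (degree p - 1) + (\<Sum>u\<in>S. linear_form (weight (vs ! u)))"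
  have tr: "frac_of trace_coeff + 4 * sig \<in> pow_ideal 4"
    using trace[unfolded cut, folded sig_def] unfolding trace_coeff_def P_def d_def
    by (simp only: frac_of.hom_add frac_of.hom_sum coeff_map_poly frac_of.hom_zero)
  \<comment> \<open>Integrality of \<open>sig\<close> makes \<open>trace_coeff\<close> divisible by
    4, so that the congruence modulo 16 can be divided by 4.\<close>
  have "sig \<in> odd_denominators"
    unfolding sig_def cut[symmetric]
  proof (intro sum_R)
    fix v u assume "v \<in> S" "u \<in> {..<?N} - S"
    then have "c v u * (c u v / (d v - d u)) \<in> odd_denominators"
      using S(1) by (intro mult_R c_R edge_quotient_R) auto
    then show "c v u * c u v / (d v - d u) \<in> odd_denominators" by simp
  qed
  then have "4 * sig \<in> pow_ideal 2"
    using four_mult_pow_ideal[of sig 0] by (simp add: pow_ideal_0 numeral_2_eq_2)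
  from pow_ideal_diff[OF pow_ideal_antimono[OF _ tr, of 2] this]
  have "frac_of trace_coeff \<in> pow_ideal 2" by simp
  then obtain L where L: "trace_coeff = 2 ^ 2 * L" unfolding frac_of_pow_ideal_iff by blast
  have "frac_of trace_coeff = 4 * frac_of L"
    unfolding L by (simp add: frac_of.hom_mult frac_of.hom_numeral frac_of.hom_power del: mult_fract)
  then have "2 * (2 * (frac_of L + sig)) \<in> pow_ideal (Suc (Suc 2))"
    using tr by (simp add: algebra_simps)
  then have "frac_of L + sig \<in> pow_ideal 2" by (simp only: two_mult_pow_ideal_iff)
  moreover have "S' \<subseteq> A" using S(1) image by (auto simp: S'_def)
  moreover have "S' \<noteq> {}" using S(2) deg by (auto simp: S'_def)
  moreover have "S' \<noteq> A"
  proof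
    assume "S' = A"
    then have "{..<?N} - S = {}" using compl by blast
    then have "card S = ?N" using S(1) by (metis Diff_eq_empty_iff card_lessThan subset_antisym)
    moreover have "degree p + degree q = ?N"
    proof -
      have "degree (P * Q) = ?N"
        using \<open>P * Q = char_poly perturbed_matrix\<close> degree_monic_char_poly[OF perturbed_matrix_carrier] by simp
      moreover have "degree (P * Q) = degree p + degree q"
        unfolding P_def Q_def using deg by (subst degree_mult_eq) auto
      ultimately show ?thesis by simp
    qed
    ultimately show False using S(2) deg(2) by simp
  qed
  ultimately show False
    using no_integral_cut[OF A(1-3), of S' L] by (simp add: sig_def)
qed

text \<open>The embedding \<open>h\<close> carries a factorisation of \<open>p\<close> to one of the
  characteristic polynomial over the larger ring of polynomials in the square roots, where
  \<open>monic_factor_trivial\<close> applies. It preserves degrees, so a factor that is constant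
  there is constant already over the small ring.\<close>

theorem theorem5:
  fixes A :: "'m :: finite elt set"
  assumes "is_graph A"
    and "connected_graph A"
    and "nondegenerate A"
    and "allowable A"
  shows "\<exists>p :: 'm mpoly poly. map_poly sq_vars p = chi A \<and> irreducible p"
proof -
  have "finite A" "A \<noteq> {}" using assms(1) by (auto simp: is_graph_def)
  then obtain vs where vs: "distinct vs" "set vs = A" using finite_distinct_list by blast
  have chi: "chi A = char_poly (matrix_of_list vs)" by (rule chi_eq[OF vs])
  have M: "matrix_of_list vs \<in> carrier_mat (length vs) (length vs)"
    by (simp add: matrix_of_list_def)
  obtain p :: "'m mpoly poly" where p: "map_poly sq_vars p = chi A"
    using char_poly_in_range[of vs] chi by metis
  define h :: "'m mpoly \<Rightarrow> nat mpoly" where "h f = to_nat_mpoly (sq_vars f)" for f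
  have inj: "h f = 0 \<longleftrightarrow> f = 0" for f
    using injD[OF inj_to_nat_mpoly, of "sq_vars f" 0] injD[OF sq_vars_inj, of f 0]
    by (auto simp: h_def sq_vars_zero to_nat_mpoly.hom_zero)
  interpret h: inj_comm_ring_hom h
    by unfold_locales (simp_all add: h_def sq_vars_zero sq_vars_one sq_vars_add sq_vars_mult
        to_nat_mpoly.hom_add to_nat_mpoly.hom_mult inj[unfolded h_def])
  interpret h_poly: map_poly_inj_comm_ring_hom h ..
  have hp: "map_poly h p = map_poly to_nat_mpoly (char_poly (matrix_of_list vs))"
    unfolding chi[symmetric] p[symmetric]
    by (subst map_poly_map_poly) (simp_all add: sq_vars_zero to_nat_mpoly.hom_zero comp_def h_def[abs_def])
  also have "\<dots> = char_poly (map_mat to_nat_mpoly (matrix_of_list vs))"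
    using to_nat_mpoly.char_poly_hom[OF M] by simp
  finally have deg_hp: "degree (map_poly h p) = length vs" and monic_hp: "lead_coeff (map_poly h p) = 1"
    using degree_monic_char_poly[of "map_mat to_nat_mpoly (matrix_of_list vs)" "length vs"] M by auto
  have pos: "length vs > 0" using vs \<open>A \<noteq> {}\<close> by auto
  have deg_p: "degree p = length vs" using deg_hp by simp
  have h_inj: "f = g" if "h f = h g" for f g using that h.injectivity by blast
  have monic_p: "lead_coeff p = 1" using monic_hp h_inj[of "lead_coeff p" 1] by simp
  \<comment> \<open>A constant factor of a monic polynomial divides the leading coefficient
    1.\<close>
  have unit: "a dvd 1" if ab: "p = a * b" and deg: "degree (map_poly h a) = 0" for a b
  proof -
    have "degree a = 0" using deg by simp
    then obtain x where a: "a = [:x:]" by (rule degree_eq_zeroE)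
    have "x * coeff b (degree p) = 1" using monic_p ab a by simp
    then have "[:x:] * [:coeff b (degree p):] = 1" by (simp add: one_pCons mult.commute)
    then show ?thesis unfolding a by (metis dvd_triv_left)
  qed
  have "irreducible p"
  proof (rule irreducibleI)
    show "p \<noteq> 0" using deg_p pos by auto
    show "\<not> p dvd 1"
    proof
      assume "p dvd 1"
      then obtain q where "1 = p * q" by blast
      then have *: "1 = map_poly h p * map_poly h q" by (metis h_poly.hom_mult h_poly.hom_one)
      then have "map_poly h q \<noteq> 0" by auto
      moreover have "map_poly h p \<noteq> 0" using monic_hp by auto
      ultimately have "degree (map_poly h p) = 0"
        using * by (metis add_is_0 degree_1 degree_mult_eq)
      then show False using deg_hp pos by simp
    qed
    fix a b assume ab: "p = a * b"
    define a' where "a' = map_poly h a"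
    define b' where "b' = map_poly h b"
    have prod: "map_poly h p = a' * b'" unfolding a'_def b'_def ab by (rule h_poly.hom_mult)
    have lead: "lead_coeff a' * lead_coeff b' = 1"
      using monic_hp unfolding prod lead_coeff_mult .
    then have nz: "lead_coeff a' \<noteq> 0" "lead_coeff b' \<noteq> 0" by auto
    \<comment> \<open>The leading coefficients are inverse to each other, so scaling each factor by
      that of the other makes both monic and keeps the product.\<close>
    have "Polynomial.smult (lead_coeff b') a' * Polynomial.smult (lead_coeff a') b' = a' * b'"
      using lead by (simp add: mult.commute)
    then have "degree (Polynomial.smult (lead_coeff b') a') = 0 \<or> degree (Polynomial.smult (lead_coeff a') b') = 0"
      using monic_factor_trivial[OF assms vs, of "Polynomial.smult (lead_coeff b') a'" "Polynomial.smult (lead_coeff a') b'"]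
        hp prod lead nz by (simp add: mult.commute)
    then have "degree a' = 0 \<or> degree b' = 0" using nz by simp
    then show "a dvd 1 \<or> b dvd 1"
      using unit[of a b] unit[of b a] ab unfolding a'_def b'_def by (auto simp: mult.commute)
  qed
  then show ?thesis using p by blast
qed

end
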